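(* Every equicontinuous lamination of codimension zero preserves a transverse metric; that is, if $(M,\mathcal{L})$ is an equicontinuous codimension zero lamination with a good foliated atlas $\mathcal{A}$, associated complete transversal $T$ and holonomy pseudogroup $\Gamma$, then there is a distance function on $T$, compatible with its topology, which is preserved by $\Gamma$.
   Context: **Laminations.** Let $M$ be a locally compact Polish space. A foliated atlas of class $C^r$ on $M$ is an atlas $\mathcal{A}=\{\varphi_i:U_i\to\mathbb{R}^n\times X_i\}$ whose changes of coordinates have the form $\varphi_i\circ\varphi_j^{-1}(x,y)=(\varphi_{ij}^y(x),\sigma_{ij}(y))$, where $\sigma_{ij}$ is a homeomorphism and $\varphi_{ij}^y$ is a $C^r$-diffeomorphism depending continuously on $y$ in the $C^r$-topology. Two foliated atlases are equivalent if their union is a foliated atlas. A lamination $(M,\mathcal{L})$ is such an $M$ with an equivalence class $\mathcal{L}$ of foliated atlases. The sets $\varphi_i^{-1}(\mathbb{R}^n\times\{y\})$ are the plaques. The space $T=\bigsqcup_iX_i$ is the complete transversal associated to $\mathcal{A}$. The lamination has codimension zero if $T$ is a locally compact Polish $0$-dimensional space. **Good atlases.** The atlas $\mathcal{A}$ is good if it is finite, the flow boxes $U_i$ are relatively compact, and whenever $U_i\cap U_j\ne\emptyset$ there is a flow box $U_{ij}$ containing $\overline{U_i\cap U_j}$ (so each plaque of $U_i$ meets at most one plaque of $U_j$). Laminations considered have a good atlas, which is fixed. **Holonomy pseudogroup.** For flow boxes $U_i,U_j$ of $\mathcal{A}$ that meet, the holonomy transformation $\sigma_{ij}:D_{ij}\subset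 X_i\to D_{ji}\subset X_j$ between open sets is the homeomorphism defined by $\sigma_{ij}(y_i)=y_j$ iff the plaques through $y_i$ and $y_j$ meet. The pseudogroup $\Gamma$ on $T$ generated by all $\sigma_{ij}$ (closed under restriction to open sets, composition, inversion and extension) is the holonomy pseudogroup. **Equicontinuity.** The lamination is equicontinuous if there is a metric $d$ on $T$ compatible with its topology such that for every $\varepsilon>0$ there is $\delta>0$ with the property: for every finite composition $\gamma=\sigma_{i_{k-1}i_k}\circ\cdots\circ\sigma_{i_0i_1}$ of holonomy transformations (on its maximal domain) and all $x,y\in\operatorname{dom}\gamma$ with $d(x,y)<\delta$, one has $d(\gamma(x),\gamma(y))<\varepsilon$. **Preserving a transverse metric.** $\Gamma$ preserves a distance function $d'$ on $T$ if every $\gamma\in\Gamma$ is locally an isometry for $d'$: every point of $\operatorname{dom}\gamma$ has a neighborhood $V\subset\operatorname{dom}\gamma$ with $d'(\gamma(x),\gamma(y))=d'(x,y)$ for all $x,y\in V$. *)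

theory Defs
  imports "HOL-Analysis.Analysis"
begin

section \<open>Topological preliminaries\<close>

definition Polish_space :: "'a topology \<Rightarrow> bool" where
  "Polish_space X \<longleftrightarrow> completely_metrizable_space X \<and> separable_space X"

definition zero_dimensional_space :: "'a topology \<Rightarrow> bool" where
  "zero_dimensional_space X \<longleftrightarrow>
     neighbourhood_base_of (\<lambda>V. openin X V \<and> closedin X V) X"

definition compatible_metric :: "'a topology \<Rightarrow> ('a \<Rightarrow> 'a \<Rightarrow> real) \<Rightarrow> bool" where
  "compatible_metric X d \<longleftrightarrow>
     Metric_space (topspace X) d \<and> Metric_space.mtopology (topspace X) d = X"


section \<open>Maps of class $C^r$ between open subsets of $R^n$\<close>

text \<open>Euclidean space of dimension $n$ is the library space \<^term>\<open>Euclidean_space n\<close>, whose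
  points are the sequences vanishing from index $n$ on, so that $n = 0$ is allowed. The class
  $C^r$ ($0 \le r \le \infty$) is expressed by iterated partial derivatives. All of these are
  used on open sets only, where they depend only on the values of the map in the set.\<close>

definition partial_deriv :: "nat \<Rightarrow> ((nat \<Rightarrow> real) \<Rightarrow> real) \<Rightarrow> (nat \<Rightarrow> real) \<Rightarrow> real" where
  "partial_deriv i f x = deriv (\<lambda>t. f (x(i := t))) (x i)"

definition iterated_partial :: "nat list \<Rightarrow> ((nat \<Rightarrow> real) \<Rightarrow> real) \<Rightarrow> (nat \<Rightarrow> real) \<Rightarrow> real" where
  "iterated_partial js f = foldr partial_deriv js f"

definition multi_indices :: "enat \<Rightarrow> nat \<Rightarrow> nat list set" where
  "multi_indices r n = {js. set js \<subseteq> {..<n} \<and> enat (length js) \<le> r}"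

definition Cr_on :: "enat \<Rightarrow> nat \<Rightarrow> (nat \<Rightarrow> real) set \<Rightarrow> ((nat \<Rightarrow> real) \<Rightarrow> nat \<Rightarrow> real) \<Rightarrow> bool" where
  "Cr_on r n S f \<longleftrightarrow>
     (\<forall>c<n. \<forall>js \<in> multi_indices r n.
        continuous_map (subtopology (Euclidean_space n) S) euclideanreal
          (iterated_partial js (\<lambda>x. f x c)) \<and>
        (\<forall>i. i # js \<in> multi_indices r n \<longrightarrow>
           (\<forall>x\<in>S. (\<lambda>t. iterated_partial js (\<lambda>z. f z c) (x(i := t)))
                     field_differentiable at (x i))))"

definition Cr_diffeo ::
    "enat \<Rightarrow> nat \<Rightarrow> (nat \<Rightarrow> real) set \<Rightarrow> (nat \<Rightarrow> real) set \<Rightarrow> ((nat \<Rightarrow> real) \<Rightarrow> nat \<Rightarrow> real) \<Rightarrow> bool" where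
  "Cr_diffeo r n S S' f \<longleftrightarrow>
     openin (Euclidean_space n) S \<and> openin (Euclidean_space n) S' \<and>
     bij_betw f S S' \<and> Cr_on r n S f \<and> Cr_on r n S' (inv_into S f)"

definition slice :: "('b \<times> 'x) set \<Rightarrow> 'x \<Rightarrow> 'b set" where
  "slice W y = {x. (x, y) \<in> W}"

text \<open>The map \<open>f y\<close> is defined on the slice of \<open>W\<close> at \<open>y\<close>. Continuity in \<open>y\<close> is with respect
  to the $C^r$ compact-open topology: uniform convergence on compact sets of all partial
  derivatives of order at most $r$ (of every finite order if $r = \infty$). The domain varies
  with \<open>y\<close>, so a compact subset of the slice at \<open>y\<^sub>0\<close> must also lie in the nearby slices.\<close>

definition Cr_continuous_family ::
    "enat \<Rightarrow> nat \<Rightarrow> 'x topology \<Rightarrow> ((nat \<Rightarrow> real) \<times> 'x) set \<Rightarrow>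
     ('x \<Rightarrow> (nat \<Rightarrow> real) \<Rightarrow> nat \<Rightarrow> real) \<Rightarrow> bool" where
  "Cr_continuous_family r n Y W f \<longleftrightarrow>
     (\<forall>y\<^sub>0 \<in> topspace Y. \<forall>K e. compactin (Euclidean_space n) K \<and> K \<subseteq> slice W y\<^sub>0 \<and> e > 0 \<longrightarrow>
        (\<forall>js \<in> multi_indices r n. \<exists>V. openin Y V \<and> y\<^sub>0 \<in> V \<and>
           (\<forall>y\<in>V. K \<subseteq> slice W y \<and>
              (\<forall>x\<in>K. \<forall>c<n.
                 \<bar>iterated_partial js (\<lambda>z. f y z c) x
                  - iterated_partial js (\<lambda>z. f y\<^sub>0 z c) x\<bar> < e))))"


section \<open>Laminations\<close>

datatype ('m, 'x) flow_chart =
  Flow_Chart (flow_box: "'m set") (transversal: "'x topology")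
    (coords: "'m \<Rightarrow> (nat \<Rightarrow> real) \<times> 'x")

definition is_flow_chart :: "nat \<Rightarrow> 'm topology \<Rightarrow> ('m, 'x) flow_chart \<Rightarrow> bool" where
  "is_flow_chart n M a \<longleftrightarrow>
     openin M (flow_box a) \<and>
     homeomorphic_map (subtopology M (flow_box a))
       (prod_topology (Euclidean_space n) (transversal a)) (coords a)"

text \<open>The change of coordinates from \<open>b\<close> to \<open>a\<close> has the form
  $(x, y) \mapsto (f_y(x), \sigma(y))$ on the image \<open>W\<close> of the overlap.\<close>

definition foliated_change ::
    "enat \<Rightarrow> nat \<Rightarrow> ('m, 'x) flow_chart \<Rightarrow> ('m, 'x) flow_chart \<Rightarrow> bool" where
  "foliated_change r n a b \<longleftrightarrow>
     (let W = coords b ` (flow_box a \<inter> flow_box b);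
          W' = coords a ` (flow_box a \<inter> flow_box b);
          Y = subtopology (transversal b) (snd ` W);
          Y' = subtopology (transversal a) (snd ` W')
      in \<exists>f \<sigma>.
        (\<forall>(x, y) \<in> W. coords a (inv_into (flow_box b) (coords b) (x, y)) = (f y x, \<sigma> y)) \<and>
        homeomorphic_map Y Y' \<sigma> \<and>
        (\<forall>y \<in> snd ` W. Cr_diffeo r n (slice W y) (slice W' (\<sigma> y)) (f y)) \<and>
        Cr_continuous_family r n Y W f)"

definition foliated_atlas ::
    "enat \<Rightarrow> nat \<Rightarrow> 'm topology \<Rightarrow> ('m, 'x) flow_chart set \<Rightarrow> bool" where
  "foliated_atlas r n M A \<longleftrightarrow>
     (\<forall>a\<in>A. is_flow_chart n M a) \<and> (\<Union>a\<in>A. flow_box a) = topspace M \<and>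
     (\<forall>a\<in>A. \<forall>b\<in>A. foliated_change r n a b)"

definition atlas_equiv ::
    "enat \<Rightarrow> nat \<Rightarrow> 'm topology \<Rightarrow> (('m, 'x) flow_chart set \<times> ('m, 'x) flow_chart set) set" where
  "atlas_equiv r n M =
     {(A, B). foliated_atlas r n M A \<and> foliated_atlas r n M B \<and> foliated_atlas r n M (A \<union> B)}"

definition lamination ::
    "enat \<Rightarrow> nat \<Rightarrow> 'm topology \<Rightarrow> ('m, 'x) flow_chart set set \<Rightarrow> bool" where
  "lamination r n M L \<longleftrightarrow>
     locally_compact_space M \<and> Polish_space M \<and>
     L \<in> {A. foliated_atlas r n M A} // atlas_equiv r n M"

text \<open>The flow box containing the closure of an overlap belongs to the lamination, that is, to
  some atlas in \<open>L\<close>, not necessarily to \<open>A\<close>.\<close>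

definition good_atlas ::
    "'m topology \<Rightarrow> ('m, 'x) flow_chart set set \<Rightarrow> ('m, 'x) flow_chart set \<Rightarrow> bool" where
  "good_atlas M L A \<longleftrightarrow>
     A \<in> L \<and> finite A \<and>
     (\<forall>a\<in>A. compactin M (M closure_of flow_box a)) \<and>
     (\<forall>a\<in>A. \<forall>b\<in>A. flow_box a \<inter> flow_box b \<noteq> {} \<longrightarrow>
        (\<exists>c \<in> \<Union>L. M closure_of (flow_box a \<inter> flow_box b) \<subseteq> flow_box c))"

definition complete_transversal ::
    "('m, 'x) flow_chart set \<Rightarrow> (('m, 'x) flow_chart \<times> 'x) topology" where
  "complete_transversal A = sum_topology transversal A"

definition codimension_zero :: "('m, 'x) flow_chart set \<Rightarrow> bool" where
  "codimension_zero A \<longleftrightarrow>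
     (let T = complete_transversal A
      in locally_compact_space T \<and> Polish_space T \<and> zero_dimensional_space T)"


section \<open>The holonomy pseudogroup\<close>

text \<open>Partially defined maps are functions into \<open>option\<close>; the composition \<open>g \<circ>\<^sub>m f\<close> is then
  defined on the maximal domain.\<close>

definition partial_homeomorphism :: "'a topology \<Rightarrow> ('a \<rightharpoonup> 'a) \<Rightarrow> bool" where
  "partial_homeomorphism X h \<longleftrightarrow>
     openin X (dom h) \<and> openin X (ran h) \<and>
     homeomorphic_map (subtopology X (dom h)) (subtopology X (ran h)) (\<lambda>x. the (h x))"

definition partial_inverse :: "('a \<rightharpoonup> 'a) \<Rightarrow> ('a \<rightharpoonup> 'a)" where
  "partial_inverse h = (\<lambda>y. if y \<in> ran h then Some (THE x. h x = Some y) else None)"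

inductive_set generated_pseudogroup :: "'a topology \<Rightarrow> ('a \<rightharpoonup> 'a) set \<Rightarrow> ('a \<rightharpoonup> 'a) set"
  for X :: "'a topology" and S :: "('a \<rightharpoonup> 'a) set" where
  generator: "g \<in> S \<Longrightarrow> g \<in> generated_pseudogroup X S"
| restriction: "\<lbrakk>g \<in> generated_pseudogroup X S; openin X V\<rbrakk> \<Longrightarrow> g |` V \<in> generated_pseudogroup X S"
| composition: "\<lbrakk>f \<in> generated_pseudogroup X S; g \<in> generated_pseudogroup X S\<rbrakk>
                \<Longrightarrow> g \<circ>\<^sub>m f \<in> generated_pseudogroup X S"
| inversion: "g \<in> generated_pseudogroup X S \<Longrightarrow> partial_inverse g \<in> generated_pseudogroup X S"
| extension: "\<lbrakk>partial_homeomorphism X h;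
               \<And>x. x \<in> dom h \<Longrightarrow>
                 \<exists>V. openin X V \<and> x \<in> V \<and> V \<subseteq> dom h \<and> h |` V \<in> generated_pseudogroup X S\<rbrakk>
              \<Longrightarrow> h \<in> generated_pseudogroup X S"

definition plaque :: "('m, 'x) flow_chart \<Rightarrow> 'x \<Rightarrow> 'm set" where
  "plaque a y = {p \<in> flow_box a. snd (coords a p) = y}"

text \<open>The value is well defined when each plaque of \<open>a\<close> meets at most one plaque of \<open>b\<close>, which
  holds for any two charts of a foliated atlas.\<close>

definition holonomy ::
    "('m, 'x) flow_chart \<Rightarrow> ('m, 'x) flow_chart \<Rightarrow>
     (('m, 'x) flow_chart \<times> 'x \<rightharpoonup> ('m, 'x) flow_chart \<times> 'x)" where
  "holonomy a b = (\<lambda>(c, y).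
     if c = a \<and> (\<exists>z. plaque a y \<inter> plaque b z \<noteq> {})
     then Some (b, THE z. plaque a y \<inter> plaque b z \<noteq> {}) else None)"

definition holonomy_transformations ::
    "('m, 'x) flow_chart set \<Rightarrow>
     (('m, 'x) flow_chart \<times> 'x \<rightharpoonup> ('m, 'x) flow_chart \<times> 'x) set" where
  "holonomy_transformations A =
     {holonomy a b | a b. a \<in> A \<and> b \<in> A \<and> flow_box a \<inter> flow_box b \<noteq> {}}"

definition holonomy_pseudogroup ::
    "('m, 'x) flow_chart set \<Rightarrow>
     (('m, 'x) flow_chart \<times> 'x \<rightharpoonup> ('m, 'x) flow_chart \<times> 'x) set" where
  "holonomy_pseudogroup A =
     generated_pseudogroup (complete_transversal A) (holonomy_transformations A)"


section \<open>Equicontinuity and invariant transverse metrics\<close>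

fun holonomy_along ::
    "('m, 'x) flow_chart list \<Rightarrow>
     (('m, 'x) flow_chart \<times> 'x \<rightharpoonup> ('m, 'x) flow_chart \<times> 'x)" where
  "holonomy_along (a # b # cs) = holonomy_along (b # cs) \<circ>\<^sub>m holonomy a b"
| "holonomy_along _ = Some"

definition flow_chain :: "('m, 'x) flow_chart set \<Rightarrow> ('m, 'x) flow_chart list \<Rightarrow> bool" where
  "flow_chain A cs \<longleftrightarrow>
     2 \<le> length cs \<and> set cs \<subseteq> A \<and> successively (\<lambda>a b. flow_box a \<inter> flow_box b \<noteq> {}) cs"

definition equicontinuous_atlas :: "('m, 'x) flow_chart set \<Rightarrow> bool" where
  "equicontinuous_atlas A \<longleftrightarrow>
     (\<exists>d. compatible_metric (complete_transversal A) d \<and>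
       (\<forall>\<epsilon>>0. \<exists>\<delta>>0. \<forall>cs. flow_chain A cs \<longrightarrow>
          (\<forall>x \<in> dom (holonomy_along cs). \<forall>y \<in> dom (holonomy_along cs).
             d x y < \<delta> \<longrightarrow> d (the (holonomy_along cs x)) (the (holonomy_along cs y)) < \<epsilon>)))"

definition preserves_metric ::
    "'a topology \<Rightarrow> ('a \<rightharpoonup> 'a) set \<Rightarrow> ('a \<Rightarrow> 'a \<Rightarrow> real) \<Rightarrow> bool" where
  "preserves_metric X \<Gamma> d \<longleftrightarrow>
     (\<forall>\<gamma>\<in>\<Gamma>. \<forall>p \<in> dom \<gamma>. \<exists>V. openin X V \<and> p \<in> V \<and> V \<subseteq> dom \<gamma> \<and>
        (\<forall>x\<in>V. \<forall>y\<in>V. d (the (\<gamma> x)) (the (\<gamma> y)) = d x y))"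

end

theory Submission
  imports Defs
begin

text \<open>Write $\pi_a$ for the projection of a flow box $U_a$ to its transversal $X_a$, viewed inside
  the complete transversal $T$. The obvious candidate for an invariant metric, the supremum of
  $d(\gamma x, \gamma y)$ over all holonomy chains $\gamma$ defined at both $x$ and $y$, need not
  satisfy the triangle inequality: a third point may lie outside the domain of the chain that
  separates $x$ from $y$. Dimension zero is what removes this obstacle, because
  domains can be cut down to compact open sets.

  A good atlas makes $M$ compact, so the flow boxes shrink to compact sets $N_a \subseteq U_a$ whose
  open cores $W_a$ still cover $M$. The compact set $\pi_a(N_a \cap N_b)$ lies in the open domain of
  the holonomy $\sigma_{ab}$, hence in a compact open subset of that domain. Restricting every
  $\sigma_{ab}$ in this way gives a finite family $S$, closed under inversion, whose domains are
  compact and open; so, for some $\epsilon_0 > 0$, two points at distance less than $\epsilon_0$ always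
  lie in the domains of the same members of $S$. Together with equicontinuity this shows that
  for $x$, $y$ close enough a composite of members of $S$ is defined at $x$ if and only if it is
  defined at $y$, and then maps them to close points. Counting "defined at only one of the
  two points" as distance $1$, the supremum over composites becomes a compatible metric $\rho$ on $T$
  (\<open>equicontinuous_family.mtopology_orbit_dist\<close>) and the members of $S$ become isometries for $\rho$.

  The family $S$ need not generate the holonomy pseudogroup, since a point of $X_a$ may be seen only by
  points of $U_a$ outside $N_a$. But every plaque of $U_a$ meets some $W_k$, and a
  connectedness argument along the plaque shows that transporting $\rho$ back from $X_k$ by
  $\sigma_{ak}$ gives, near a given point, a result independent of the choice of $k$
  (\<open>leafwise_invariant_metric.plaque_independence\<close>). As $T$ is Lindelof and zero-dimensional,
  $k$ can be chosen as a locally constant function $\kappa$ on $T$. The required metric compares $x$, $y$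
  with the same chart $a$ and the same $\kappa$ through the $\rho$-distance of their images under
  $\sigma_{a\kappa}$, and gives distance $1$ to all other pairs. Independence of $k$ is
  precisely its local invariance under each $\sigma_{ab}$, and local isometries survive the
  operations that generate a pseudogroup.\<close>

section \<open>Separable metric and zero-dimensional spaces\<close>

text \<open>Balls of radius \<open>1/(n+1)\<close> around a countable dense set that fit into a member of the cover
  already cover the space; keeping one member for each such ball gives the countable subcover.\<close>

lemma (in Metric_space) separable_imp_Lindelof:
  assumes "separable_space mtopology"
  shows "Lindelof_space mtopology"
  unfolding Lindelof_space_def
proof (intro allI impI)
  fix \<U> assume \<U>: "(\<forall>U\<in>\<U>. openin mtopology U) \<and> \<Union>\<U> = topspace mtopology"
  obtain C where C: "countable C" "C \<subseteq> M" "mtopology closure_of C = M"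
    using assms unfolding separable_space_def by auto
  define I where "I = {(c, n::nat). c \<in> C \<and> (\<exists>U\<in>\<U>. mball c (inverse (Suc n)) \<subseteq> U)}"
  define u where "u = (\<lambda>(c, n::nat). SOME U. U \<in> \<U> \<and> mball c (inverse (Suc n)) \<subseteq> U)"
  have u: "u (c, n) \<in> \<U> \<and> mball c (inverse (Suc n)) \<subseteq> u (c, n)" if "(c, n) \<in> I" for c n
    using that unfolding I_def u_def by simp (smt (verit, best) someI_ex)
  have "countable I"
    by (rule countable_subset [of _ "C \<times> UNIV"]) (auto simp: I_def C)
  have "x \<in> \<Union>(u ` I)" if "x \<in> M" for x
  proof -
    obtain U r where U: "U \<in> \<U>" "x \<in> U" "r > 0" "mball x r \<subseteq> U"
      using \<open>x \<in> M\<close> \<U> by (metis UnionE openin_mtopology topspace_mtopology)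
    obtain n where n: "inverse (Suc n) < r / 2"
      using reals_Archimedean \<open>r > 0\<close> by (metis half_gt_zero)
    obtain c where c: "c \<in> C" "c \<in> mball x (inverse (Suc n))"
    proof -
      have "x \<in> mtopology closure_of C" using C(3) \<open>x \<in> M\<close> by simp
      then have "\<exists>c\<in>C. c \<in> mball x (inverse (real (Suc n)))"
        unfolding metric_closure_of by simp
      then show ?thesis using that by blast
    qed
    have "mball c (inverse (Suc n)) \<subseteq> mball x r"
    proof
      fix y assume y: "y \<in> mball c (inverse (Suc n))"
      then have "d x y \<le> d x c + d c y" using c that by (auto intro: triangle)
      then show "y \<in> mball x r" using y c n by auto
    qed
    then have "(c, n) \<in> I" using c U by (auto simp: I_def)
    moreover have "x \<in> mball c (inverse (Suc n))"
      using c commute by auto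
    ultimately show ?thesis using u by blast
  qed
  then have "\<Union>(u ` I) = topspace mtopology"
  proof (intro subset_antisym)
    show "\<Union>(u ` I) \<subseteq> topspace mtopology" using u \<U> by (metis UN_least Union_upper prod.collapse)
  qed auto
  then show "\<exists>\<V>. countable \<V> \<and> \<V> \<subseteq> \<U> \<and> \<Union>\<V> = topspace mtopology"
    using \<open>countable I\<close> u by (intro exI [of _ "u ` I"]) auto
qed

lemma Polish_imp_Lindelof:
  assumes "Polish_space X" shows "Lindelof_space X"
  using assms Metric_space.separable_imp_Lindelof
    unfolding Polish_space_def completely_metrizable_space_def by metis

lemma Polish_imp_Hausdorff:
  assumes "Polish_space X" shows "Hausdorff_space X"
  using assms unfolding Polish_space_def
  by (simp add: completely_metrizable_imp_metrizable_space metrizable_imp_Hausdorff_space)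

text \<open>A countable clopen refinement \<open>B\<^sub>0, B\<^sub>1, \<dots>\<close> of the cover is made disjoint by sending a point to the
  least \<open>n\<close> with \<open>x \<in> B\<^sub>n\<close>; the level sets of this function are differences of clopen sets.\<close>

lemma locally_constant_selection:
  assumes "zero_dimensional_space X" and "Lindelof_space X"
    and "\<And>x. x \<in> topspace X \<Longrightarrow> \<exists>k\<in>K. x \<in> U k" and "\<And>k. k \<in> K \<Longrightarrow> openin X (U k)"
  obtains f where "\<And>x. x \<in> topspace X \<Longrightarrow> f x \<in> K \<and> x \<in> U (f x)"
    and "\<And>k. openin X {x \<in> topspace X. f x = k}"
proof (cases "topspace X = {}")
  case True
  then show ?thesis using that [of undefined] by auto
next
  case False
  define \<B> where "\<B> = {B. openin X B \<and> closedin X B \<and> (\<exists>k\<in>K. B \<subseteq> U k)}"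
  have "x \<in> \<Union>\<B>" if "x \<in> topspace X" for x
  proof -
    obtain k where "k \<in> K" "x \<in> U k" using assms(3) \<open>x \<in> topspace X\<close> by blast
    then show ?thesis
      using assms(1) assms(4) [of k] unfolding zero_dimensional_space_def neighbourhood_base_of \<B>_def
      by (auto, meson in_mono)
  qed
  then have "\<Union>\<B> = topspace X" unfolding \<B>_def using openin_subset by fast
  moreover have "openin X B" if "B \<in> \<B>" for B using that by (simp add: \<B>_def)
  ultimately obtain \<V> where \<V>: "countable \<V>" "\<V> \<subseteq> \<B>" "\<Union>\<V> = topspace X"
    using assms(2) unfolding Lindelof_space_def by metis
  then have "\<V> \<noteq> {}" using False by (metis Union_empty)
  define B where "B = from_nat_into \<V>"
  have B: "B n \<in> \<B>" for n
    using \<V> \<open>\<V> \<noteq> {}\<close> B_def from_nat_into by (metis subsetD)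
  have cov: "\<exists>n. x \<in> B n" if "x \<in> topspace X" for x
    using that \<V> \<open>\<V> \<noteq> {}\<close> from_nat_into_surj unfolding B_def by (metis UnionE)
  define l where "l x = (LEAST n. x \<in> B n)" for x
  have l: "x \<in> B (l x)" if "x \<in> topspace X" for x
    using cov [OF that] unfolding l_def by (metis LeastI)
  have "\<exists>k. \<forall>n. k n \<in> K \<and> B n \<subseteq> U (k n)"
    using B unfolding \<B>_def by (intro choice) auto
  then obtain k where k: "\<And>n. k n \<in> K \<and> B n \<subseteq> U (k n)" by blast
  have fib: "openin X {x \<in> topspace X. l x = n}" for n
  proof -
    have "{x \<in> topspace X. l x = n} = B n - (\<Union>i<n. B i)"
    proof (intro set_eqI iffI)
      fix x assume "x \<in> {x \<in> topspace X. l x = n}"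
      then show "x \<in> B n - (\<Union>i<n. B i)" using l not_less_Least unfolding l_def by blast
    next
      fix x assume x: "x \<in> B n - (\<Union>i<n. B i)"
      then have "l x = n" unfolding l_def
        by (intro Least_equality) (auto simp: not_less [symmetric])
      moreover have "x \<in> topspace X"
        using x B [of n] openin_subset unfolding \<B>_def by blast
      ultimately show "x \<in> {x \<in> topspace X. l x = n}" by simp
    qed
    moreover have "closedin X (\<Union>i<n. B i)"
      using B by (intro closedin_Union) (auto simp: \<B>_def)
    ultimately show ?thesis using B [of n] by (auto simp: \<B>_def intro: openin_diff)
  qed
  show ?thesis
  proof
    show "(k \<circ> l) x \<in> K \<and> x \<in> U ((k \<circ> l) x)" if "x \<in> topspace X" for x
      using k l [OF that] by auto
    show "openin X {x \<in> topspace X. (k \<circ> l) x = j}" for j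
    proof -
      have "{x \<in> topspace X. (k \<circ> l) x = j} = (\<Union>n\<in>{n. k n = j}. {x \<in> topspace X. l x = n})"
        by auto
      then show ?thesis using fib by (auto intro: openin_Union)
    qed
  qed
qed

lemma compact_open_between:
  assumes "locally_compact_space X" "Hausdorff_space X" "zero_dimensional_space X"
    and E: "compactin X E" and D: "openin X D" "E \<subseteq> D"
  obtains C where "compactin X C" "openin X C" "E \<subseteq> C" "C \<subseteq> D"
proof -
  define \<B> where "\<B> = {B. openin X B \<and> compactin X B \<and> B \<subseteq> D}"
  have "x \<in> \<Union>\<B>" if "x \<in> E" for x
  proof -
    have "x \<in> topspace X" using that E compactin_subset_topspace by blast
    then obtain O' Q where O: "openin X O'" "compactin X Q" "x \<in> O'" "O' \<subseteq> Q"
      using assms(1) unfolding locally_compact_space_def by meson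
    have "openin X (O' \<inter> D)" "x \<in> O' \<inter> D" using O D that by auto
    then obtain U V where "openin X U" "openin X V" "closedin X V" "x \<in> U" "U \<subseteq> V" "V \<subseteq> O' \<inter> D"
      using assms(3) unfolding zero_dimensional_space_def neighbourhood_base_of by meson
    moreover have "compactin X V"
      using closed_compactin [OF O(2)] calculation O by blast
    ultimately show ?thesis unfolding \<B>_def by blast
  qed
  then have "E \<subseteq> \<Union>\<B>" by blast
  moreover have "\<forall>B\<in>\<B>. openin X B" by (simp add: \<B>_def)
  ultimately obtain \<F> where \<F>: "finite \<F>" "\<F> \<subseteq> \<B>" "E \<subseteq> \<Union>\<F>"
    using E unfolding compactin_def by meson
  show thesis
  proof
    show "compactin X (\<Union>\<F>)" using \<F> by (auto simp: \<B>_def intro: compactin_Union)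
    show "openin X (\<Union>\<F>)" using \<F> by (auto simp: \<B>_def)
    show "\<Union>\<F> \<subseteq> D" using \<F> by (auto simp: \<B>_def)
  qed (use \<F> in auto)
qed

lemma compact_shrinking:
  assumes "compact_space X" "Hausdorff_space X"
    and op: "\<And>a. a \<in> A \<Longrightarrow> openin X (U a)" and cov: "(\<Union>a\<in>A. U a) = topspace X"
  obtains W N where "\<And>a. a \<in> A \<Longrightarrow> openin X (W a) \<and> compactin X (N a) \<and> W a \<subseteq> N a \<and> N a \<subseteq> U a"
    and "(\<Union>a\<in>A. W a) = topspace X"
proof -
  have "neighbourhood_base_of (closedin X) X"
    using assms compact_Hausdorff_or_regular_imp_normal_space neighbourhood_base_of_closedin
      compact_Hausdorff_imp_regular_space by blast
  then have nb: "\<exists>O' Q. openin X O' \<and> compactin X Q \<and> x \<in> O' \<and> O' \<subseteq> Q \<and> Q \<subseteq> U a"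
    if "a \<in> A" "x \<in> U a" for x a
    using that op [of a] closedin_compact_space [OF assms(1)] unfolding neighbourhood_base_of by meson
  define \<T> where "\<T> = {(a, O', Q). a \<in> A \<and> openin X O' \<and> compactin X Q \<and> O' \<subseteq> Q \<and> Q \<subseteq> U a}"
  have "topspace X \<subseteq> \<Union>((\<lambda>(a, O', Q). O') ` \<T>)"
  proof
    fix x assume "x \<in> topspace X"
    then obtain a where "a \<in> A" "x \<in> U a" using cov by blast
    then show "x \<in> \<Union>((\<lambda>(a, O', Q). O') ` \<T>)"
      using nb [of a x] unfolding \<T>_def by fastforce
  qed
  moreover have "\<forall>V \<in> (\<lambda>(a, O', Q). O') ` \<T>. openin X V" by (auto simp: \<T>_def)
  moreover have "compactin X (topspace X)" using assms(1) compact_space_def by blast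
  ultimately obtain \<F>0 where "finite \<F>0" "\<F>0 \<subseteq> (\<lambda>(a, O', Q). O') ` \<T>" "topspace X \<subseteq> \<Union>\<F>0"
    unfolding compactin_def by meson
  then obtain \<F> where \<F>: "finite \<F>" "\<F> \<subseteq> \<T>" "topspace X \<subseteq> \<Union>((\<lambda>(a, O', Q). O') ` \<F>)"
    by (metis finite_subset_image)
  define W where "W a = \<Union>{O'. \<exists>Q. (a, O', Q) \<in> \<F>}" for a
  define N where "N a = \<Union>{Q. \<exists>O'. (a, O', Q) \<in> \<F>}" for a
  have mem: "a \<in> A \<and> openin X O' \<and> compactin X Q \<and> O' \<subseteq> Q \<and> Q \<subseteq> U a" if "(a, O', Q) \<in> \<F>" for a O' Q
    using that \<F>(2) unfolding \<T>_def by blast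
  show thesis
  proof
    fix a assume "a \<in> A"
    have "{Q. \<exists>O'. (a, O', Q) \<in> \<F>} \<subseteq> (\<lambda>(a, O', Q). Q) ` \<F>" by force
    then have "finite {Q. \<exists>O'. (a, O', Q) \<in> \<F>}" using \<F>(1) finite_surj by blast
    then have "compactin X (N a)" unfolding N_def using mem by (intro compactin_Union) auto
    moreover have "openin X (W a)" unfolding W_def using mem by (intro openin_Union) auto
    moreover have "W a \<subseteq> N a" "N a \<subseteq> U a" unfolding W_def N_def using mem by blast+
    ultimately show "openin X (W a) \<and> compactin X (N a) \<and> W a \<subseteq> N a \<and> N a \<subseteq> U a" by blast
  next
    have "topspace X \<subseteq> (\<Union>a\<in>A. W a)"
    proof
      fix x assume "x \<in> topspace X"
      then obtain a O' Q where "(a, O', Q) \<in> \<F>" "x \<in> O'" using \<F>(3) by auto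
      then have "a \<in> A" "x \<in> W a" using mem unfolding W_def by blast+
      then show "x \<in> (\<Union>a\<in>A. W a)" by blast
    qed
    moreover have "W a \<subseteq> topspace X" for a
      unfolding W_def using mem openin_subset by blast
    ultimately show "(\<Union>a\<in>A. W a) = topspace X" by blast
  qed
qed

text \<open>A Lebesgue number of the cover \<open>{C}\<close> of \<open>C\<close> bounds from below the distance from \<open>C\<close> to its
  complement.\<close>

lemma (in Metric_space) compact_open_separated:
  assumes "compactin mtopology C" "openin mtopology C"
  shows "\<exists>\<epsilon>>0. \<forall>x\<in>M. \<forall>y\<in>M. d x y < \<epsilon> \<longrightarrow> (x \<in> C \<longleftrightarrow> y \<in> C)"
proof -
  obtain \<epsilon> where "\<epsilon> > 0" and \<epsilon>: "\<And>x. x \<in> C \<Longrightarrow> mball x \<epsilon> \<subseteq> C"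
    using lebesgue_number [of C "{C}"] assms by auto
  have "y \<in> C" if "x \<in> M" "y \<in> M" "d x y < \<epsilon>" "x \<in> C" for x y
    using \<epsilon> [OF that(4)] that by auto
  then show ?thesis using \<open>\<epsilon> > 0\<close> commute by metis
qed

lemma (in Metric_space) finite_compact_open_separated:
  assumes "finite \<C>" "\<And>C. C \<in> \<C> \<Longrightarrow> compactin mtopology C \<and> openin mtopology C"
  shows "\<exists>\<epsilon>>0. \<forall>C\<in>\<C>. \<forall>x\<in>M. \<forall>y\<in>M. d x y < \<epsilon> \<longrightarrow> (x \<in> C \<longleftrightarrow> y \<in> C)"
  using assms
proof (induction \<C> rule: finite_induct)
  case empty
  then show ?case using zero_less_one by blast
next
  case (insert C \<C>)
  then obtain \<epsilon>1 where 1: "\<epsilon>1 > 0" "\<forall>C\<in>\<C>. \<forall>x\<in>M. \<forall>y\<in>M. d x y < \<epsilon>1 \<longrightarrow> (x \<in> C \<longleftrightarrow> y \<in> C)"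
    by auto
  obtain \<epsilon>2 where 2: "\<epsilon>2 > 0" "\<forall>x\<in>M. \<forall>y\<in>M. d x y < \<epsilon>2 \<longrightarrow> (x \<in> C \<longleftrightarrow> y \<in> C)"
    using compact_open_separated insert.prems by blast
  have "min \<epsilon>1 \<epsilon>2 > 0" using 1(1) 2(1) by simp
  moreover have "\<forall>C'\<in>insert C \<C>. \<forall>x\<in>M. \<forall>y\<in>M. d x y < min \<epsilon>1 \<epsilon>2 \<longrightarrow> (x \<in> C' \<longleftrightarrow> y \<in> C')"
    using 1(2) 2(2) by (metis insertE min_less_iff_conj)
  ultimately show ?case by blast
qed

section \<open>The orbit metric of an equicontinuous family of partial maps\<close>

text \<open>The value \<^term>\<open>None\<close> plays the role of an isolated point at distance 1 from everything else,
  so that a partial map becomes a total one and the triangle inequality holds without any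
  restriction on domains.\<close>

fun option_dist :: "('a \<Rightarrow> 'a \<Rightarrow> real) \<Rightarrow> 'a option \<Rightarrow> 'a option \<Rightarrow> real" where
  "option_dist d (Some x) (Some y) = min 1 (d x y)"
| "option_dist d None None = 0"
| "option_dist d _ _ = 1"

primrec composite :: "('a \<rightharpoonup> 'a) list \<Rightarrow> ('a \<rightharpoonup> 'a)" where
  "composite [] = Some"
| "composite (g # gs) = composite gs \<circ>\<^sub>m g"

definition orbit_dist :: "('a \<rightharpoonup> 'a) set \<Rightarrow> ('a \<Rightarrow> 'a \<Rightarrow> real) \<Rightarrow> 'a \<Rightarrow> 'a \<Rightarrow> real" where
  "orbit_dist S d x y = (SUP w\<in>lists S. option_dist d (composite w x) (composite w y))"

lemma composite_snoc: "composite (w @ [g]) = g \<circ>\<^sub>m composite w"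
  by (induction w) (auto simp: map_comp_def fun_eq_iff split: option.splits)

text \<open>Uniform separation of the domains from their complements, in \<open>dom_separated\<close>, is what will let
  equicontinuity, which compares only points where a composite is defined, say that nearby points
  have the same composites.\<close>

locale equicontinuous_family = Metric_space T d
  for T :: "'a set" and d and S :: "('a \<rightharpoonup> 'a) set" +
  assumes ran_subset: "g \<in> S \<Longrightarrow> ran g \<subseteq> T"
    and dom_separated:
      "\<exists>\<epsilon>>0. \<forall>g\<in>S. \<forall>x\<in>T. \<forall>y\<in>T. d x y < \<epsilon> \<longrightarrow> (x \<in> dom g \<longleftrightarrow> y \<in> dom g)"
    and equicontinuous: "\<epsilon> > 0 \<Longrightarrow>
      \<exists>\<delta>>0. \<forall>w\<in>lists S. \<forall>x\<in>T. \<forall>y\<in>T. \<forall>x' y'. composite w x = Some x' \<and> composite w y = Some y' \<and>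
        d x y < \<delta> \<longrightarrow> d x' y' < \<epsilon>"
begin

lemma composite_in:
  assumes "w \<in> lists S" "x \<in> T" "composite w x = Some y" shows "y \<in> T"
  using assms
proof (induction w arbitrary: x rule: list.induct)
  case (Cons g w)
  then obtain z where "g x = Some z" "composite w z = Some y"
    by (auto simp: map_comp_def split: option.splits)
  moreover then have "z \<in> T" using ran_subset [of g] Cons.prems(1) by (auto intro: ranI)
  ultimately show ?case using Cons by auto
qed auto

lemma option_dist_triangle:
  assumes "set_option u \<subseteq> T" "set_option v \<subseteq> T" "set_option w \<subseteq> T"
  shows "option_dist d u w \<le> option_dist d u v + option_dist d v w"
proof -
  have nn: "0 \<le> option_dist d u v" "0 \<le> option_dist d v w" by (cases u; cases v; cases w; simp)+
  show ?thesis
  proof (cases u)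
    case None
    then show ?thesis using nn by (cases v; cases w) auto
  next
    case (Some x)
    note u = this
    show ?thesis
    proof (cases w)
      case None
      then show ?thesis using u nn by (cases v) auto
    next
      case (Some z)
      show ?thesis
      proof (cases v)
        case (Some y)
        then have "d x z \<le> d x y + d y z"
          using u \<open>w = Some z\<close> assms by (auto intro: triangle)
        then show ?thesis using u \<open>w = Some z\<close> Some nonneg [of x y] nonneg [of y z]
          by (simp add: min_def del: nonneg)
      qed (use Some u in auto)
    qed
  qed
qed

lemma option_dist_bounds: "0 \<le> option_dist d u v" "option_dist d u v \<le> 1"
  by (cases u; cases v; simp)+

lemma bdd: "bdd_above ((\<lambda>w. option_dist d (composite w x) (composite w y)) ` lists S)"
  using option_dist_bounds by (meson bdd_aboveI2)

lemma orbit_dist_upper: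
  "w \<in> lists S \<Longrightarrow> option_dist d (composite w x) (composite w y) \<le> orbit_dist S d x y"
  unfolding orbit_dist_def by (rule cSUP_upper [OF _ bdd])

lemma orbit_dist_least:
  "(\<And>w. w \<in> lists S \<Longrightarrow> option_dist d (composite w x) (composite w y) \<le> c) \<Longrightarrow> orbit_dist S d x y \<le> c"
  unfolding orbit_dist_def by (intro cSUP_least) auto

lemma orbit_dist_le_1: "orbit_dist S d x y \<le> 1"
  by (intro orbit_dist_least option_dist_bounds)

lemma orbit_dist_ge: "min 1 (d x y) \<le> orbit_dist S d x y"
  using orbit_dist_upper [of "[]" x y] by simp

lemma Metric_space_orbit_dist: "Metric_space T (orbit_dist S d)"
proof
  show "0 \<le> orbit_dist S d x y" for x y
    using orbit_dist_ge [of x y] nonneg [of x y] by linarith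
  have od: "option_dist d u v = option_dist d v u" for u v
    by (cases u; cases v; simp add: commute)
  show "orbit_dist S d x y = orbit_dist S d y x" for x y
    unfolding orbit_dist_def by (subst od) simp
  show "orbit_dist S d x y = 0 \<longleftrightarrow> x = y" if "x \<in> T" "y \<in> T" for x y
  proof
    assume "orbit_dist S d x y = 0"
    then have "d x y = 0" using orbit_dist_ge [of x y] nonneg [of x y] by linarith
    then show "x = y" using that by simp
  next
    assume "x = y"
    have "option_dist d (composite w x) (composite w x) \<le> 0" if "w \<in> lists S" for w
      using composite_in [OF that \<open>x \<in> T\<close>] by (cases "composite w x") auto
    then have "orbit_dist S d x x \<le> 0" by (intro orbit_dist_least)
    moreover have "0 \<le> orbit_dist S d x x"
      using orbit_dist_ge [of x x] nonneg [of x x] by linarith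
    ultimately show "orbit_dist S d x y = 0" using \<open>x = y\<close> by simp
  qed
  show "orbit_dist S d x z \<le> orbit_dist S d x y + orbit_dist S d y z"
    if "x \<in> T" "y \<in> T" "z \<in> T" for x y z
  proof (rule orbit_dist_least)
    fix w assume w: "w \<in> lists S"
    then have "set_option (composite w u) \<subseteq> T" if "u \<in> T" for u
      using composite_in [OF w that] by (cases "composite w u") auto
    then have "option_dist d (composite w x) (composite w z)
        \<le> option_dist d (composite w x) (composite w y) + option_dist d (composite w y) (composite w z)"
      using that by (intro option_dist_triangle) auto
    also have "\<dots> \<le> orbit_dist S d x y + orbit_dist S d y z"
      using w by (intro add_mono orbit_dist_upper)
    finally show "option_dist d (composite w x) (composite w z) \<le> \<dots>" .
  qed
qed

text \<open>By induction on the length of a composite, nearby points remain closer than the separation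
  constant after each step, so the next map is defined at both of the current points or at neither.\<close>

lemma option_dist_composite_small:
  assumes "\<epsilon> > 0"
  obtains \<delta> where "\<delta> > 0"
    and "\<And>w x y. w \<in> lists S \<Longrightarrow> x \<in> T \<Longrightarrow> y \<in> T \<Longrightarrow> d x y < \<delta> \<Longrightarrow>
           option_dist d (composite w x) (composite w y) < \<epsilon>"
proof -
  obtain \<epsilon>0 where \<epsilon>0: "\<epsilon>0 > 0"
    "\<And>g x y. g \<in> S \<Longrightarrow> x \<in> T \<Longrightarrow> y \<in> T \<Longrightarrow> d x y < \<epsilon>0 \<Longrightarrow> x \<in> dom g \<longleftrightarrow> y \<in> dom g"
    using dom_separated by metis
  have "min \<epsilon> \<epsilon>0 > 0" using assms \<epsilon>0 by simp
  then obtain \<delta> where "\<delta> > 0" and \<delta>: "\<forall>w\<in>lists S. \<forall>x\<in>T. \<forall>y\<in>T. \<forall>x' y'.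
      composite w x = Some x' \<and> composite w y = Some y' \<and> d x y < \<delta> \<longrightarrow> d x' y' < min \<epsilon> \<epsilon>0"
    using equicontinuous by meson
  have same: "composite w x = None \<longleftrightarrow> composite w y = None"
    if "w \<in> lists S" "x \<in> T" "y \<in> T" "d x y < \<delta>" for w x y
    using that
  proof (induction w rule: rev_induct)
    case (snoc g w)
    then have w: "w \<in> lists S" "g \<in> S" by auto
    have IH: "composite w x = None \<longleftrightarrow> composite w y = None" using snoc w by blast
    show ?case
    proof (cases "composite w x")
      case None
      then show ?thesis using IH by (simp add: composite_snoc map_comp_def)
    next
      case (Some x')
      then obtain y' where y': "composite w y = Some y'" using IH by (cases "composite w y") auto
      have "d x' y' < \<epsilon>0" using \<delta> w(1) snoc.prems Some y' by (metis min_less_iff_conj)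
      moreover have "x' \<in> T" "y' \<in> T" using composite_in w(1) snoc.prems Some y' by blast+
      ultimately have "x' \<in> dom g \<longleftrightarrow> y' \<in> dom g" using \<epsilon>0(2) w(2) by blast
      then show ?thesis using Some y' by (auto simp: composite_snoc map_comp_def)
    qed
  qed auto
  show thesis
  proof
    show "\<delta> > 0" by fact
    fix w x y assume w: "w \<in> lists S" "x \<in> T" "y \<in> T" "d x y < \<delta>"
    show "option_dist d (composite w x) (composite w y) < \<epsilon>"
    proof (cases "composite w x")
      case None
      then show ?thesis using same [OF w] assms by simp
    next
      case (Some x')
      then obtain y' where y': "composite w y = Some y'"
        using same [OF w] by (cases "composite w y") auto
      then have "d x' y' < \<epsilon>" using \<delta> w Some by (metis min_less_iff_conj)
      then show ?thesis using Some y' by simp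
    qed
  qed
qed

lemma mtopology_orbit_dist: "Metric_space.mtopology T (orbit_dist S d) = mtopology"
proof -
  interpret orb: Metric_space T "orbit_dist S d" by (rule Metric_space_orbit_dist)
  show ?thesis
    unfolding topology_eq
  proof (intro allI iffI)
    fix U assume U: "openin orb.mtopology U"
    show "openin mtopology U"
      unfolding openin_mtopology
    proof (intro conjI allI impI)
      show "U \<subseteq> T" using U orb.openin_mtopology by blast
      fix x assume "x \<in> U"
      then obtain r where r: "r > 0" "orb.mball x r \<subseteq> U" using U orb.openin_mtopology by blast
      have "x \<in> T" using \<open>U \<subseteq> T\<close> \<open>x \<in> U\<close> by blast
      obtain \<delta> where \<delta>: "\<delta> > 0" "\<And>w x y. w \<in> lists S \<Longrightarrow> x \<in> T \<Longrightarrow> y \<in> T \<Longrightarrow> d x y < \<delta> \<Longrightarrow>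
           option_dist d (composite w x) (composite w y) < r / 2"
        using option_dist_composite_small [of "r / 2"] r(1) by (metis half_gt_zero)
      have "mball x \<delta> \<subseteq> orb.mball x r"
      proof
        fix y assume y: "y \<in> mball x \<delta>"
        then have "orbit_dist S d x y \<le> r / 2"
          using \<delta>(2) by (intro orbit_dist_least less_imp_le) auto
        then show "y \<in> orb.mball x r" using y r(1) by auto
      qed
      then show "\<exists>r>0. mball x r \<subseteq> U" using \<delta>(1) r by blast
    qed
  next
    fix U assume U: "openin mtopology U"
    show "openin orb.mtopology U"
      unfolding orb.openin_mtopology
    proof (intro conjI allI impI)
      show "U \<subseteq> T" using U openin_mtopology by blast
      fix x assume "x \<in> U"
      then obtain r where r: "r > 0" "mball x r \<subseteq> U" using U openin_mtopology by blast
      \<comment> \<open>The orbit metric dominates \<open>min 1 d\<close>, so it says nothing about \<open>d\<close> beyond radius 1.\<close>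
      have "orb.mball x (min 1 r) \<subseteq> mball x r"
      proof
        fix y assume y: "y \<in> orb.mball x (min 1 r)"
        then show "y \<in> mball x r" using orbit_dist_ge [of x y] by auto
      qed
      then show "\<exists>r>0. orb.mball x r \<subseteq> U" using r by (intro exI [of _ "min 1 r"]) auto
    qed
  qed
qed

text \<open>Applying \<open>g\<close> first turns every composite into another composite, so the supremum for the images
  runs over fewer terms.\<close>

lemma orbit_dist_map_le:
  assumes "g \<in> S" "g x = Some x'" "g y = Some y'"
  shows "orbit_dist S d x' y' \<le> orbit_dist S d x y"
proof (rule orbit_dist_least)
  fix w assume "w \<in> lists S"
  then have "g # w \<in> lists S" using assms(1) by simp
  then show "option_dist d (composite w x') (composite w y') \<le> orbit_dist S d x y"
    using orbit_dist_upper [of "g # w" x y] assms by simp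
qed

end

section \<open>Pulling back a metric along a map that is injective on the fibres of a label\<close>

text \<open>The label separates the sheets on which \<open>h\<close> is injective; points on different sheets get the
  distance 1, an upper bound for \<open>\<rho>\<close> in all uses, which keeps the triangle inequality.\<close>

definition labelled_pullback ::
    "('a \<Rightarrow> 'l) \<Rightarrow> ('a \<Rightarrow> 'b) \<Rightarrow> ('b \<Rightarrow> 'b \<Rightarrow> real) \<Rightarrow> 'a \<Rightarrow> 'a \<Rightarrow> real" where
  "labelled_pullback l h \<rho> x y = (if l x = l y then \<rho> (h x) (h y) else 1)"

lemma compatible_labelled_pullback:
  assumes \<rho>: "compatible_metric Y \<rho>" and le1: "\<And>x y. \<rho> x y \<le> 1"
    and l: "\<And>k. openin X {x \<in> topspace X. l x = k}"
    and cont: "continuous_map X Y h" and open_h: "open_map X Y h"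
    and inj: "\<And>x y. \<lbrakk>x \<in> topspace X; y \<in> topspace X; l x = l y; h x = h y\<rbrakk> \<Longrightarrow> x = y"
  shows "compatible_metric X (labelled_pullback l h \<rho>)"
proof -
  interpret R: Metric_space "topspace Y" \<rho> using \<rho> by (simp add: compatible_metric_def)
  have Y: "R.mtopology = Y" using \<rho> by (simp add: compatible_metric_def)
  have hY: "h x \<in> topspace Y" if "x \<in> topspace X" for x
    using cont that by (auto simp: continuous_map_def)
  let ?d = "labelled_pullback l h \<rho>"
  interpret D: Metric_space "topspace X" ?d
  proof
    show "0 \<le> ?d x y" for x y by (simp add: labelled_pullback_def)
    show "?d x y = ?d y x" for x y by (auto simp: labelled_pullback_def R.commute)
    show "?d x y = 0 \<longleftrightarrow> x = y" if "x \<in> topspace X" "y \<in> topspace X" for x y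
      using that inj hY by (auto simp: labelled_pullback_def)
    show "?d x z \<le> ?d x y + ?d y z"
      if "x \<in> topspace X" "y \<in> topspace X" "z \<in> topspace X" for x y z
    proof -
      have "\<rho> (h x) (h z) \<le> \<rho> (h x) (h y) + \<rho> (h y) (h z)"
        using R.triangle hY that by blast
      moreover have "0 \<le> \<rho> (h x) (h y)" "0 \<le> \<rho> (h y) (h z)" by simp_all
      ultimately show ?thesis using le1 [of "h x" "h z"] unfolding labelled_pullback_def by argo
    qed
  qed
  have "D.mtopology = X"
    unfolding topology_eq
  proof (intro allI iffI)
    fix U assume U: "openin D.mtopology U"
    then have sub: "U \<subseteq> topspace X" by (simp add: D.openin_mtopology)
    have "\<exists>V. openin X V \<and> x \<in> V \<and> V \<subseteq> U" if "x \<in> U" for x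
    proof -
      obtain r where r: "r > 0" "D.mball x r \<subseteq> U"
        using U \<open>x \<in> U\<close> D.openin_mtopology by meson
      define V where "V = {y \<in> topspace X. l y = l x} \<inter> {y \<in> topspace X. h y \<in> R.mball (h x) r}"
      have "openin Y (R.mball (h x) r)" using R.openin_mball Y by metis
      then have "openin X V"
        unfolding V_def using l cont by (intro openin_Int openin_continuous_map_preimage)
      moreover have "x \<in> V" using that sub hY r(1) by (auto simp: V_def)
      moreover have "V \<subseteq> D.mball x r" using that sub by (auto simp: V_def labelled_pullback_def)
      ultimately show ?thesis using r(2) by blast
    qed
    then show "openin X U" by (subst openin_subopen) blast
  next
    fix U assume U: "openin X U"
    show "openin D.mtopology U"
      unfolding D.openin_mtopology
    proof (intro conjI allI impI)
      show "U \<subseteq> topspace X" using U openin_subset by blast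
      fix x assume x: "x \<in> U"
      define V where "V = U \<inter> {y \<in> topspace X. l y = l x}"
      have "openin X V" unfolding V_def using U l by blast
      then have "openin R.mtopology (h ` V)" using open_h Y unfolding open_map_def by simp
      moreover have "h x \<in> h ` V" using x \<open>U \<subseteq> topspace X\<close> by (auto simp: V_def)
      ultimately obtain r where r: "r > 0" "R.mball (h x) r \<subseteq> h ` V"
        using R.openin_mtopology by meson
      \<comment> \<open>Radius at most 1 keeps the ball inside the sheet of \<open>x\<close>.\<close>
      have "D.mball x (min 1 r) \<subseteq> U"
      proof
        fix y assume y: "y \<in> D.mball x (min 1 r)"
        then have "l y = l x" "y \<in> topspace X" "h y \<in> R.mball (h x) r"
          using hY by (auto simp: labelled_pullback_def split: if_splits)
        then obtain z where "z \<in> V" "h y = h z" using r(2) by blast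
        then have "y = z" using inj \<open>l y = l x\<close> \<open>y \<in> topspace X\<close> by (auto simp: V_def)
        then show "y \<in> U" using \<open>z \<in> V\<close> by (simp add: V_def)
      qed
      then show "\<exists>r>0. D.mball x r \<subseteq> U" using r(1) by (intro exI [of _ "min 1 r"]) auto
    qed
  qed
  then show ?thesis using D.Metric_space_axioms by (simp add: compatible_metric_def)
qed

section \<open>Local isometries are stable under the pseudogroup operations\<close>

definition locally_isometric :: "'a topology \<Rightarrow> ('a \<Rightarrow> 'a \<Rightarrow> real) \<Rightarrow> ('a \<rightharpoonup> 'a) \<Rightarrow> bool" where
  "locally_isometric X d g \<longleftrightarrow>
     (\<forall>p \<in> dom g. \<exists>V. openin X V \<and> p \<in> V \<and> V \<subseteq> dom g \<and>
        (\<forall>x\<in>V. \<forall>y\<in>V. d (the (g x)) (the (g y)) = d x y))"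

text \<open>Continuity and openness are both stated through the graph of \<open>g\<close>, which makes the notion
  visibly symmetric under inversion and easy to compose. With injectivity this describes a homeomorphism
  between open subsets.\<close>

definition bicontinuous :: "'a topology \<Rightarrow> ('a \<rightharpoonup> 'a) \<Rightarrow> bool" where
  "bicontinuous X g \<longleftrightarrow> inj_on g (dom g) \<and> dom g \<subseteq> topspace X \<and> ran g \<subseteq> topspace X \<and>
     (\<forall>U. openin X U \<longrightarrow> openin X {x. \<exists>y\<in>U. g x = Some y} \<and> openin X {y. \<exists>x\<in>U. g x = Some y})"

lemma locally_isometricE:
  assumes "locally_isometric X d g" "p \<in> dom g"
  obtains V where "openin X V" "p \<in> V" "V \<subseteq> dom g"
    "\<And>x y. x \<in> V \<Longrightarrow> y \<in> V \<Longrightarrow> d (the (g x)) (the (g y)) = d x y"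
proof -
  have "\<exists>V. openin X V \<and> p \<in> V \<and> V \<subseteq> dom g \<and> (\<forall>x\<in>V. \<forall>y\<in>V. d (the (g x)) (the (g y)) = d x y)"
    using assms unfolding locally_isometric_def by (rule bspec)
  then show thesis using that by (elim exE conjE) simp
qed

lemma bicontinuous_inj:
  "\<lbrakk>bicontinuous X g; g x = Some z; g y = Some z\<rbrakk> \<Longrightarrow> x = y"
  unfolding bicontinuous_def inj_on_def by (metis domI)

lemma partial_inverse_eq_Some:
  assumes "bicontinuous X g"
  shows "partial_inverse g y = Some x \<longleftrightarrow> g x = Some y"
proof
  assume "g x = Some y"
  then have "(THE x. g x = Some y) = x" using bicontinuous_inj [OF assms] by blast
  then show "partial_inverse g y = Some x"
    using \<open>g x = Some y\<close> by (auto simp: partial_inverse_def ran_def)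
next
  assume L: "partial_inverse g y = Some x"
  then obtain x' where "g x' = Some y"
    by (auto simp: partial_inverse_def ran_def split: if_splits)
  moreover then have "(THE x. g x = Some y) = x'" using bicontinuous_inj [OF assms] by blast
  ultimately show "g x = Some y"
    using L by (auto simp: partial_inverse_def split: if_splits)
qed

lemma bicontinuous_restrict:
  assumes "bicontinuous X g" "openin X V" shows "bicontinuous X (g |` V)"
proof -
  have "{x. \<exists>y\<in>U. (g |` V) x = Some y} = V \<inter> {x. \<exists>y\<in>U. g x = Some y}"
    "{y. \<exists>x\<in>U. (g |` V) x = Some y} = {y. \<exists>x\<in>U \<inter> V. g x = Some y}" for U
    by (auto simp: restrict_map_def split: if_splits)
  moreover have "inj_on (g |` V) (dom (g |` V))"
    by (rule inj_onI) (metis assms(1) bicontinuous_inj domD restrict_in restrict_out option.distinct(1))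
  moreover have "ran (g |` V) \<subseteq> ran g" by (auto simp: ran_def restrict_map_def split: if_splits)
  ultimately show ?thesis
    using assms unfolding bicontinuous_def by (auto intro!: openin_Int)
qed

lemma bicontinuous_comp:
  assumes "bicontinuous X f" "bicontinuous X g" shows "bicontinuous X (g \<circ>\<^sub>m f)"
proof -
  have gf: "(g \<circ>\<^sub>m f) x = Some z \<longleftrightarrow> (\<exists>y. f x = Some y \<and> g y = Some z)" for x z
    by (auto simp: map_comp_def split: option.splits)
  have eq: "{x. \<exists>y\<in>U. (g \<circ>\<^sub>m f) x = Some y} = {x. \<exists>y\<in>{y. \<exists>z\<in>U. g y = Some z}. f x = Some y}"
    "{y. \<exists>x\<in>U. (g \<circ>\<^sub>m f) x = Some y} = {z. \<exists>y\<in>{y. \<exists>x\<in>U. f x = Some y}. g y = Some z}" for U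
    using gf by auto
  have "inj_on (g \<circ>\<^sub>m f) (dom (g \<circ>\<^sub>m f))"
  proof (rule inj_onI)
    fix x x' assume "x \<in> dom (g \<circ>\<^sub>m f)" "(g \<circ>\<^sub>m f) x = (g \<circ>\<^sub>m f) x'"
    then obtain z y y' where "f x = Some y" "g y = Some z" "f x' = Some y'" "g y' = Some z"
      by (metis domD gf)
    then show "x = x'" using bicontinuous_inj assms by metis
  qed
  moreover have "dom (g \<circ>\<^sub>m f) \<subseteq> dom f" "ran (g \<circ>\<^sub>m f) \<subseteq> ran g" using gf by (auto simp: ran_def)
  ultimately show ?thesis
    using assms by (auto simp: bicontinuous_def eq)
qed

lemma bicontinuous_partial_inverse:
  assumes "bicontinuous X g" shows "bicontinuous X (partial_inverse g)"
proof -
  note inv = partial_inverse_eq_Some [OF assms]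
  have "inj_on (partial_inverse g) (dom (partial_inverse g))"
    by (rule inj_onI) (metis domD inv option.inject)
  moreover have "dom (partial_inverse g) = ran g" "ran (partial_inverse g) = dom g"
    using inv by (auto simp: dom_def ran_def)
  ultimately show ?thesis
    using assms by (simp add: bicontinuous_def inv)
qed

lemma partial_homeomorphism_imp_bicontinuous:
  assumes "partial_homeomorphism X h" shows "bicontinuous X h"
proof -
  let ?f = "\<lambda>x. the (h x)"
  have d: "openin X (dom h)" and r: "openin X (ran h)"
    and f: "homeomorphic_map (subtopology X (dom h)) (subtopology X (ran h)) ?f"
    using assms by (auto simp: partial_homeomorphism_def)
  have td: "topspace (subtopology X (dom h)) = dom h" using openin_subset [OF d] by auto
  have "inj_on ?f (dom h)" using f td homeomorphic_imp_injective_map by metis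
  then have "inj_on h (dom h)" unfolding inj_on_def by metis
  moreover have "openin X {x. \<exists>y\<in>U. h x = Some y}" if "openin X U" for U
  proof -
    have "openin (subtopology X (ran h)) (ran h \<inter> U)"
      using that r by (simp add: openin_open_subtopology openin_Int)
    then have "openin (subtopology X (dom h)) {x \<in> topspace (subtopology X (dom h)). ?f x \<in> ran h \<inter> U}"
      using f homeomorphic_imp_continuous_map openin_continuous_map_preimage by blast
    moreover have "{x \<in> topspace (subtopology X (dom h)). ?f x \<in> ran h \<inter> U} = {x. \<exists>y\<in>U. h x = Some y}"
      unfolding td by (auto simp: ran_def)
    ultimately show ?thesis using d openin_trans_full by metis
  qed
  moreover have "openin X {y. \<exists>x\<in>U. h x = Some y}" if "openin X U" for U
  proof -
    have "openin (subtopology X (dom h)) (dom h \<inter> U)"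
      using that d by (simp add: openin_open_subtopology openin_Int)
    then have "openin (subtopology X (ran h)) (?f ` (dom h \<inter> U))"
      using f homeomorphic_imp_open_map unfolding open_map_def by blast
    moreover have "?f ` (dom h \<inter> U) = {y. \<exists>x\<in>U. h x = Some y}" by force
    ultimately show ?thesis using r openin_trans_full by metis
  qed
  moreover have "dom h \<subseteq> topspace X" "ran h \<subseteq> topspace X" using d r openin_subset by auto
  ultimately show ?thesis by (simp add: bicontinuous_def)
qed

lemma locally_isometric_comp:
  assumes f: "bicontinuous X f" "locally_isometric X d f" and g: "locally_isometric X d g"
  shows "locally_isometric X d (g \<circ>\<^sub>m f)"
  unfolding locally_isometric_def
proof
  fix p assume p: "p \<in> dom (g \<circ>\<^sub>m f)"
  obtain q where q: "f p = Some q" "q \<in> dom g"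
  proof (cases "f p")
    case (Some q)
    then have "q \<in> dom g" using p by (auto simp: map_comp_def)
    then show ?thesis using Some that by blast
  qed (use p in \<open>simp add: map_comp_def dom_def\<close>)
  have "p \<in> dom f" using q(1) by blast
  then obtain V where V: "openin X V" "p \<in> V" "V \<subseteq> dom f"
    "\<And>x y. x \<in> V \<Longrightarrow> y \<in> V \<Longrightarrow> d (the (f x)) (the (f y)) = d x y"
    using locally_isometricE [OF f(2)] by metis
  obtain W where W: "openin X W" "q \<in> W" "W \<subseteq> dom g"
    "\<And>x y. x \<in> W \<Longrightarrow> y \<in> W \<Longrightarrow> d (the (g x)) (the (g y)) = d x y"
    using locally_isometricE [OF g q(2)] by metis
  let ?V = "V \<inter> {x. \<exists>y\<in>W. f x = Some y}"
  have "openin X ?V" using V(1) W(1) f(1) unfolding bicontinuous_def by blast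
  moreover have "p \<in> ?V" using V(2) W(2) q by blast
  moreover have "?V \<subseteq> dom (g \<circ>\<^sub>m f)" using W(3) by (auto simp: map_comp_def)
  moreover have "d (the ((g \<circ>\<^sub>m f) x)) (the ((g \<circ>\<^sub>m f) y)) = d x y" if "x \<in> ?V" "y \<in> ?V" for x y
  proof -
    obtain x' y' where xy: "f x = Some x'" "x' \<in> W" "f y = Some y'" "y' \<in> W" using \<open>x \<in> ?V\<close> \<open>y \<in> ?V\<close> by blast
    then have "d (the ((g \<circ>\<^sub>m f) x)) (the ((g \<circ>\<^sub>m f) y)) = d x' y'" using W(4) by simp
    then show ?thesis using V(4) xy that by (metis IntD1 option.sel)
  qed
  ultimately show "\<exists>V. openin X V \<and> p \<in> V \<and> V \<subseteq> dom (g \<circ>\<^sub>m f) \<and>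
      (\<forall>x\<in>V. \<forall>y\<in>V. d (the ((g \<circ>\<^sub>m f) x)) (the ((g \<circ>\<^sub>m f) y)) = d x y)"
    by blast
qed

lemma locally_isometric_partial_inverse:
  assumes g: "bicontinuous X g" "locally_isometric X d g"
  shows "locally_isometric X d (partial_inverse g)"
  unfolding locally_isometric_def
proof
  note inv = partial_inverse_eq_Some [OF g(1)]
  fix q assume "q \<in> dom (partial_inverse g)"
  then obtain p where p: "g p = Some q" using inv by (auto simp: dom_def)
  then have "p \<in> dom g" by blast
  then obtain V where V: "openin X V" "p \<in> V" "V \<subseteq> dom g"
    "\<And>x y. x \<in> V \<Longrightarrow> y \<in> V \<Longrightarrow> d (the (g x)) (the (g y)) = d x y"
    using locally_isometricE [OF g(2)] by metis
  let ?V = "{y. \<exists>x\<in>V. g x = Some y}"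
  have "openin X ?V" using V(1) g(1) unfolding bicontinuous_def by blast
  moreover have "q \<in> ?V" using V(2) p by blast
  moreover have "?V \<subseteq> dom (partial_inverse g)" using inv by blast
  moreover have "d (the (partial_inverse g x)) (the (partial_inverse g y)) = d x y"
    if "x \<in> ?V" "y \<in> ?V" for x y
  proof -
    obtain x' y' where xy: "x' \<in> V" "g x' = Some x" "y' \<in> V" "g y' = Some y"
      using \<open>x \<in> ?V\<close> \<open>y \<in> ?V\<close> by blast
    then have "partial_inverse g x = Some x'" "partial_inverse g y = Some y'" using inv by auto
    then show ?thesis using V(4) [OF xy(1) xy(3)] xy by simp
  qed
  ultimately show "\<exists>V. openin X V \<and> q \<in> V \<and> V \<subseteq> dom (partial_inverse g) \<and>
      (\<forall>x\<in>V. \<forall>y\<in>V. d (the (partial_inverse g x)) (the (partial_inverse g y)) = d x y)"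
    by blast
qed

lemma locally_isometric_locally:
  assumes "\<And>x. x \<in> dom h \<Longrightarrow>
    \<exists>V. openin X V \<and> x \<in> V \<and> V \<subseteq> dom h \<and> locally_isometric X d (h |` V)"
  shows "locally_isometric X d h"
  unfolding locally_isometric_def
proof
  fix p assume "p \<in> dom h"
  then obtain V where V: "openin X V" "p \<in> V" "V \<subseteq> dom h" "locally_isometric X d (h |` V)"
    using assms by blast
  then have "p \<in> dom (h |` V)" by auto
  then obtain W where W: "openin X W" "p \<in> W" "W \<subseteq> dom (h |` V)"
    "\<And>x y. x \<in> W \<Longrightarrow> y \<in> W \<Longrightarrow> d (the ((h |` V) x)) (the ((h |` V) y)) = d x y"
    using locally_isometricE [OF V(4)] by metis
  then have "W \<subseteq> dom h" "W \<subseteq> V" by auto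
  then have "\<forall>x\<in>W. \<forall>y\<in>W. d (the (h x)) (the (h y)) = d x y"
    using W(4) by (metis restrict_in subsetD)
  then show "\<exists>V. openin X V \<and> p \<in> V \<and> V \<subseteq> dom h \<and>
      (\<forall>x\<in>V. \<forall>y\<in>V. d (the (h x)) (the (h y)) = d x y)"
    using W \<open>W \<subseteq> dom h\<close> by blast
qed

lemma locally_isometric_restrict:
  assumes "locally_isometric X d g" "openin X V" shows "locally_isometric X d (g |` V)"
  unfolding locally_isometric_def
proof
  fix p assume p: "p \<in> dom (g |` V)"
  then have "p \<in> dom g" "p \<in> V" by auto
  then obtain W where W: "openin X W" "p \<in> W" "W \<subseteq> dom g"
    "\<And>x y. x \<in> W \<Longrightarrow> y \<in> W \<Longrightarrow> d (the (g x)) (the (g y)) = d x y"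
    using locally_isometricE [OF assms(1)] by metis
  have "\<forall>x\<in>W \<inter> V. \<forall>y\<in>W \<inter> V. d (the ((g |` V) x)) (the ((g |` V) y)) = d x y"
    using W(4) by simp
  moreover have "W \<inter> V \<subseteq> dom (g |` V)" "p \<in> W \<inter> V" using W \<open>p \<in> V\<close> by auto
  ultimately show "\<exists>V'. openin X V' \<and> p \<in> V' \<and> V' \<subseteq> dom (g |` V) \<and>
      (\<forall>x\<in>V'. \<forall>y\<in>V'. d (the ((g |` V) x)) (the ((g |` V) y)) = d x y)"
    using W(1) assms(2) by (intro exI [of _ "W \<inter> V"]) auto
qed

text \<open>Rule induction needs bicontinuity alongside local isometry: the neighbourhoods for a composition
  and for an inverse are a preimage and an image.\<close>

lemma generated_pseudogroup_preserves_metric: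
  assumes "\<And>g. g \<in> S \<Longrightarrow> bicontinuous X g" and "\<And>g. g \<in> S \<Longrightarrow> locally_isometric X d g"
  shows "preserves_metric X (generated_pseudogroup X S) d"
proof -
  have "bicontinuous X g \<and> locally_isometric X d g" if "g \<in> generated_pseudogroup X S" for g
    using that
  proof (induction rule: generated_pseudogroup.induct)
    case (generator g)
    then show ?case using assms by blast
  next
    case (restriction g V)
    then show ?case using bicontinuous_restrict locally_isometric_restrict by blast
  next
    case (composition f g)
    then show ?case using bicontinuous_comp locally_isometric_comp by blast
  next
    case (inversion g)
    then show ?case using bicontinuous_partial_inverse locally_isometric_partial_inverse by blast
  next
    case (extension h)
    have "locally_isometric X d h"
      by (rule locally_isometric_locally) (use extension.IH in blast)
    then show ?case using partial_homeomorphism_imp_bicontinuous [OF extension.hyps(1)] by blast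
  qed
  then show ?thesis unfolding preserves_metric_def locally_isometric_def by blast
qed

section \<open>Charts as submersions onto the transversal\<close>

definition transverse_coord :: "('m, 'x) flow_chart \<Rightarrow> 'm \<Rightarrow> ('m, 'x) flow_chart \<times> 'x" where
  "transverse_coord a p = (a, snd (coords a p))"

text \<open>The argument works with the transverse coordinates: they are continuous and open, the flow boxes cover
  \<open>M\<close>, the fibres in a flow box are its plaques, which are nonempty and connected, and on an overlap
  two points share a plaque of one chart if and only if they share a plaque of the other.\<close>

locale foliated_space =
  fixes r :: enat and n :: nat and M :: "'m topology" and A :: "('m, 'x) flow_chart set"
  assumes atlas: "foliated_atlas r n M A"
begin

abbreviation "T \<equiv> complete_transversal A"

lemma flow_box_open: "a \<in> A \<Longrightarrow> openin M (flow_box a)"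
  using atlas by (auto simp: foliated_atlas_def is_flow_chart_def)

lemma coords_homeo:
  "a \<in> A \<Longrightarrow> homeomorphic_map (subtopology M (flow_box a))
     (prod_topology (Euclidean_space n) (transversal a)) (coords a)"
  using atlas by (auto simp: foliated_atlas_def is_flow_chart_def)

lemma topspace_flow_box: "a \<in> A \<Longrightarrow> topspace (subtopology M (flow_box a)) = flow_box a"
  using flow_box_open openin_subset by fastforce

lemma transverse_coord_alt: "transverse_coord a = (Pair a \<circ> snd) \<circ> coords a"
  by (auto simp: transverse_coord_def)

lemma continuous_transverse_coord:
  assumes "a \<in> A" shows "continuous_map (subtopology M (flow_box a)) T (transverse_coord a)"
  unfolding transverse_coord_alt complete_transversal_def
  by (intro continuous_map_compose [OF homeomorphic_imp_continuous_map [OF coords_homeo [OF assms]]]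
      continuous_map_compose [OF continuous_map_snd] continuous_map_component_injection assms)

lemma open_transverse_coord:
  assumes "a \<in> A" shows "open_map (subtopology M (flow_box a)) T (transverse_coord a)"
  unfolding transverse_coord_alt complete_transversal_def
  by (intro open_map_compose [OF homeomorphic_imp_open_map [OF coords_homeo [OF assms]]]
      open_map_compose [OF open_map_snd] open_map_component_injection assms)

lemma open_image_transverse_coord:
  assumes "a \<in> A" "openin M O'" "O' \<subseteq> flow_box a" shows "openin T (transverse_coord a ` O')"
  using open_transverse_coord [OF assms(1)] assms flow_box_open
  unfolding open_map_def by (simp add: openin_open_subtopology)

lemma open_preimage_transverse_coord:
  assumes "a \<in> A" "openin T V" shows "openin M {p \<in> flow_box a. transverse_coord a p \<in> V}"
proof -
  have "openin (subtopology M (flow_box a)) {p \<in> flow_box a. transverse_coord a p \<in> V}"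
    using openin_continuous_map_preimage [OF continuous_transverse_coord [OF assms(1)] assms(2)]
    unfolding topspace_flow_box [OF assms(1)] .
  then show ?thesis using flow_box_open [OF assms(1)] openin_trans_full by blast
qed

lemma transverse_coord_in:
  assumes "a \<in> A" "p \<in> flow_box a" shows "transverse_coord a p \<in> topspace T"
  using continuous_transverse_coord [OF assms(1)] topspace_flow_box [OF assms(1)] assms(2)
  unfolding continuous_map_def by auto

lemma transverse_coord_surj:
  assumes "s \<in> topspace T"
  obtains p where "fst s \<in> A" "p \<in> flow_box (fst s)" "transverse_coord (fst s) p = s"
proof -
  obtain a y where s: "s = (a, y)" "a \<in> A" "y \<in> topspace (transversal a)"
    using assms by (auto simp: complete_transversal_def)
  have "(\<lambda>_. 0) \<in> topspace (Euclidean_space n)" by (simp add: topspace_Euclidean_space)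
  then obtain x where "x \<in> topspace (Euclidean_space n)" by blast
  then have "(x, y) \<in> topspace (prod_topology (Euclidean_space n) (transversal a))"
    using s by simp
  then obtain p where "p \<in> flow_box a" "coords a p = (x, y)"
    using homeomorphic_imp_surjective_map [OF coords_homeo [OF s(2)]] topspace_flow_box [OF s(2)]
    by (metis imageE)
  then show thesis using that [of p] s by (auto simp: transverse_coord_def)
qed

text \<open>The fibre is either empty or the image of a copy of Euclidean space under the inverse chart.\<close>

lemma connectedin_transverse_fibre:
  assumes "a \<in> A" shows "connectedin M {p \<in> flow_box a. transverse_coord a p = s}"
proof (cases "s \<in> {a} \<times> topspace (transversal a)")
  case True
  then obtain y where s: "s = (a, y)" "y \<in> topspace (transversal a)" by auto
  obtain g where g: "homeomorphic_maps (subtopology M (flow_box a))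
      (prod_topology (Euclidean_space n) (transversal a)) (coords a) g"
    using coords_homeo [OF assms] homeomorphic_map_maps by blast
  let ?F = "topspace (Euclidean_space n) \<times> {y}"
  have "connectedin (prod_topology (Euclidean_space n) (transversal a)) ?F"
    using s connected_Euclidean_space by (auto simp: connectedin_Times connectedin_topspace)
  then have "connectedin (subtopology M (flow_box a)) (g ` ?F)"
    using g connectedin_continuous_map_image unfolding homeomorphic_maps_def by blast
  then have "connectedin M (g ` ?F)" by (simp add: connectedin_subtopology)
  moreover have "g ` ?F = {p \<in> flow_box a. transverse_coord a p = s}"
  proof (intro set_eqI iffI)
    fix p assume "p \<in> g ` ?F"
    then obtain x where x: "x \<in> topspace (Euclidean_space n)" "p = g (x, y)" by auto
    then have "(x, y) \<in> topspace (prod_topology (Euclidean_space n) (transversal a))"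
      using s by simp
    then have "coords a p = (x, y)" "p \<in> topspace (subtopology M (flow_box a))"
      using g x unfolding homeomorphic_maps_def continuous_map_def by auto
    then show "p \<in> {p \<in> flow_box a. transverse_coord a p = s}"
      using s topspace_flow_box [OF assms] by (auto simp: transverse_coord_def)
  next
    fix p assume p: "p \<in> {p \<in> flow_box a. transverse_coord a p = s}"
    then have "p \<in> topspace (subtopology M (flow_box a))" using topspace_flow_box [OF assms] by simp
    then have "g (coords a p) = p"
      "coords a p \<in> topspace (prod_topology (Euclidean_space n) (transversal a))"
      using g unfolding homeomorphic_maps_def continuous_map_def by auto
    moreover from this have "coords a p \<in> ?F"
      using p s by (cases "coords a p") (auto simp: transverse_coord_def)
    ultimately show "p \<in> g ` ?F" by (metis imageI)
  qed
  ultimately show ?thesis by simp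
next
  case False
  have "{p \<in> flow_box a. transverse_coord a p = s} = {}"
    using False transverse_coord_in [OF assms]
    by (auto simp: complete_transversal_def transverse_coord_def)
  then show ?thesis by (metis connectedin_empty)
qed

text \<open>On the overlap the transverse coordinate of \<open>a\<close> is a function \<open>\<sigma>\<close> of that of \<open>b\<close>, because the change
  of coordinates is foliated.\<close>

lemma transverse_coord_eq_imp:
  assumes "a \<in> A" "b \<in> A" "p \<in> flow_box a \<inter> flow_box b" "q \<in> flow_box a \<inter> flow_box b"
    and eq: "transverse_coord b p = transverse_coord b q"
  shows "transverse_coord a p = transverse_coord a q"
proof -
  have "foliated_change r n a b" using atlas assms by (simp add: foliated_atlas_def)
  then obtain f \<sigma> where *: "\<forall>(x, y) \<in> coords b ` (flow_box a \<inter> flow_box b).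
      coords a (inv_into (flow_box b) (coords b) (x, y)) = (f y x, \<sigma> y)"
    unfolding foliated_change_def Let_def by meson
  have inj: "inj_on (coords b) (flow_box b)"
    using homeomorphic_imp_injective_map [OF coords_homeo [OF assms(2)]]
      topspace_flow_box [OF assms(2)] by simp
  have \<sigma>: "snd (coords a u) = \<sigma> (snd (coords b u))" if u: "u \<in> flow_box a \<inter> flow_box b" for u
  proof -
    obtain x y where xy: "coords b u = (x, y)" by fastforce
    then have "(x, y) \<in> coords b ` (flow_box a \<inter> flow_box b)" using u by (metis imageI)
    then have "coords a (inv_into (flow_box b) (coords b) (x, y)) = (f y x, \<sigma> y)"
      using * by blast
    then show ?thesis using inv_into_f_f [OF inj] u xy by (metis IntD2 snd_conv)
  qed
  show ?thesis using \<sigma> [OF assms(3)] \<sigma> [OF assms(4)] eq by (simp add: transverse_coord_def)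
qed

section \<open>Holonomy transformations\<close>

text \<open>The graph of a holonomy transformation is the image of the overlap of the two flow boxes, and all
  its topological properties are read off from this description.\<close>

lemma holonomy_eq_Some:
  assumes "a \<in> A" "b \<in> A"
  shows "holonomy a b s = Some t \<longleftrightarrow>
    (\<exists>p \<in> flow_box a \<inter> flow_box b. transverse_coord a p = s \<and> transverse_coord b p = t)"
proof -
  obtain c y where s: "s = (c, y)" by fastforce
  have meet: "plaque a y \<inter> plaque b z \<noteq> {} \<longleftrightarrow>
      (\<exists>p \<in> flow_box a \<inter> flow_box b. snd (coords a p) = y \<and> snd (coords b p) = z)" for z
    by (auto simp: plaque_def)
  have uniq: "z = z'" if "plaque a y \<inter> plaque b z \<noteq> {}" "plaque a y \<inter> plaque b z' \<noteq> {}" for z z'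
  proof -
    obtain p p' where "p \<in> flow_box b \<inter> flow_box a" "snd (coords a p) = y" "snd (coords b p) = z"
      "p' \<in> flow_box b \<inter> flow_box a" "snd (coords a p') = y" "snd (coords b p') = z'"
      using \<open>plaque a y \<inter> plaque b z \<noteq> {}\<close> \<open>plaque a y \<inter> plaque b z' \<noteq> {}\<close> unfolding meet by blast
    then show ?thesis
      using transverse_coord_eq_imp [OF assms(2,1), of p p'] by (simp add: transverse_coord_def)
  qed
  have the: "(THE z. plaque a y \<inter> plaque b z \<noteq> {}) = z" if "plaque a y \<inter> plaque b z \<noteq> {}" for z
    using that uniq by blast
  show ?thesis
  proof
    assume "holonomy a b s = Some t"
    then obtain z where "c = a" "plaque a y \<inter> plaque b z \<noteq> {}" "t = (b, z)"
      using the s unfolding holonomy_def by (auto split: if_splits)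
    then show "\<exists>p \<in> flow_box a \<inter> flow_box b. transverse_coord a p = s \<and> transverse_coord b p = t"
      using s unfolding meet by (auto simp: transverse_coord_def)
  next
    assume "\<exists>p \<in> flow_box a \<inter> flow_box b. transverse_coord a p = s \<and> transverse_coord b p = t"
    then obtain z where "c = a" "plaque a y \<inter> plaque b z \<noteq> {}" "t = (b, z)"
      using s unfolding meet by (auto simp: transverse_coord_def)
    then show "holonomy a b s = Some t" using the s unfolding holonomy_def by auto
  qed
qed

lemma holonomy_transverse_coord:
  assumes "a \<in> A" "b \<in> A" "p \<in> flow_box a" "p \<in> flow_box b"
  shows "holonomy a b (transverse_coord a p) = Some (transverse_coord b p)"
  using holonomy_eq_Some [OF assms(1,2)] assms by blast

lemma holonomy_sym:
  assumes "a \<in> A" "b \<in> A"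
  shows "holonomy a b s = Some t \<longleftrightarrow> holonomy b a t = Some s"
  using holonomy_eq_Some assms by (metis IntD1 IntD2 IntI)

lemma holonomy_fst:
  assumes "a \<in> A" "b \<in> A" "holonomy a b s = Some t" shows "fst s = a \<and> fst t = b"
  using assms holonomy_eq_Some [OF assms(1,2)] by (auto simp: transverse_coord_def)

lemma openin_holonomy_preimage:
  assumes "a \<in> A" "b \<in> A" "openin T V"
  shows "openin T {x. \<exists>y\<in>V. holonomy a b x = Some y}"
proof -
  let ?O = "flow_box a \<inter> {p \<in> flow_box b. transverse_coord b p \<in> V}"
  have "openin M ?O"
    using open_preimage_transverse_coord [OF assms(2,3)] flow_box_open [OF assms(1)] by blast
  then have "openin T (transverse_coord a ` ?O)"
    using open_image_transverse_coord [OF assms(1)] by blast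
  moreover have "transverse_coord a ` ?O = {x. \<exists>y\<in>V. holonomy a b x = Some y}"
    unfolding holonomy_eq_Some [OF assms(1,2)] by blast
  ultimately show ?thesis by simp
qed

lemma bicontinuous_holonomy:
  assumes "a \<in> A" "b \<in> A" shows "bicontinuous T (holonomy a b)"
  unfolding bicontinuous_def
proof (intro conjI allI impI)
  show "inj_on (holonomy a b) (dom (holonomy a b))"
    by (rule inj_onI) (metis assms domD holonomy_sym option.inject)
  show "dom (holonomy a b) \<subseteq> topspace T" "ran (holonomy a b) \<subseteq> topspace T"
  proof -
    have "s \<in> topspace T \<and> t \<in> topspace T" if "holonomy a b s = Some t" for s t
      using that transverse_coord_in assms unfolding holonomy_eq_Some [OF assms] by blast
    then show "dom (holonomy a b) \<subseteq> topspace T" "ran (holonomy a b) \<subseteq> topspace T"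
      unfolding dom_def ran_def by blast+
  qed
  fix U assume U: "openin T U"
  show "openin T {x. \<exists>y\<in>U. holonomy a b x = Some y}"
    using openin_holonomy_preimage [OF assms U] .
  show "openin T {y. \<exists>x\<in>U. holonomy a b x = Some y}"
    using openin_holonomy_preimage [OF assms(2,1) U] holonomy_sym [OF assms] by simp
qed

lemma openin_dom_holonomy:
  assumes "a \<in> A" "b \<in> A" shows "openin T (dom (holonomy a b))"
proof -
  have "dom (holonomy a b) = {x. \<exists>y\<in>topspace T. holonomy a b x = Some y}"
    using bicontinuous_holonomy [OF assms] unfolding bicontinuous_def ran_def by blast
  then show ?thesis using openin_holonomy_preimage [OF assms openin_topspace] by simp
qed

text \<open>The neighbourhood is the projection of the triple overlap; over it each point of the transversal
  has a witness in all three flow boxes at once.\<close>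

lemma holonomy_cocycle:
  assumes "i \<in> A" "j \<in> A" "k \<in> A" "p \<in> flow_box i \<inter> flow_box j \<inter> flow_box k"
  obtains V where "openin T V" "transverse_coord i p \<in> V"
    "\<And>x. x \<in> V \<Longrightarrow> \<exists>y z. holonomy i j x = Some y \<and> holonomy j k y = Some z \<and> holonomy i k x = Some z"
proof
  let ?O = "flow_box i \<inter> flow_box j \<inter> flow_box k"
  show "openin T (transverse_coord i ` ?O)"
    using open_image_transverse_coord flow_box_open assms by (metis inf.cobounded1 inf_assoc openin_Int)
  show "transverse_coord i p \<in> transverse_coord i ` ?O" using assms(4) by blast
  show "\<exists>y z. holonomy i j x = Some y \<and> holonomy j k y = Some z \<and> holonomy i k x = Some z"
    if "x \<in> transverse_coord i ` ?O" for x
    using that holonomy_transverse_coord assms by blast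
qed

end

section \<open>A metric preserved by short holonomy\<close>

text \<open>Here \<open>\<rho>\<close> is known to be invariant only under the holonomy between charts \<open>a\<close> and \<open>b\<close>, and only near
  plaques through a common point of the smaller sets \<open>W a\<close> and \<open>W b\<close>.\<close>

locale leafwise_invariant_metric = foliated_space r n M A
  for r :: enat and n :: nat and M :: "'m topology" and A :: "('m, 'x) flow_chart set" +
  fixes W :: "('m, 'x) flow_chart \<Rightarrow> 'm set"
    and \<rho> :: "('m, 'x) flow_chart \<times> 'x \<Rightarrow> ('m, 'x) flow_chart \<times> 'x \<Rightarrow> real"
  assumes W_open: "a \<in> A \<Longrightarrow> openin M (W a)"
    and W_subset: "a \<in> A \<Longrightarrow> W a \<subseteq> flow_box a"
    and W_cover: "(\<Union>a\<in>A. W a) = topspace M"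
    and short: "\<lbrakk>a \<in> A; b \<in> A; p \<in> W a; p \<in> W b\<rbrakk> \<Longrightarrow>
       \<exists>V. openin T V \<and> transverse_coord a p \<in> V \<and> V \<subseteq> dom (holonomy a b) \<and>
         (\<forall>x\<in>V. \<forall>y\<in>V. \<rho> (the (holonomy a b x)) (the (holonomy a b y)) = \<rho> x y)"
begin

lemma W_coverE:
  assumes "a \<in> A" "p \<in> flow_box a"
  obtains k where "k \<in> A" "p \<in> W k"
proof -
  have "p \<in> topspace M" using assms flow_box_open openin_subset by blast
  then show thesis using W_cover that by blast
qed

text \<open>Fix \<open>k\<close> and call \<open>m\<close> good if transport of \<open>\<rho>\<close> from \<open>k\<close> and from \<open>m\<close> agree near \<open>s\<close>. If the plaque has a
  point in \<open>W l \<inter> W m\<close>, then short holonomy from \<open>l\<close> to \<open>m\<close> preserves \<open>\<rho>\<close> near it, so \<open>l\<close> is good if and only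
  if \<open>m\<close> is. Hence the sets \<open>W m\<close> with \<open>m\<close> good and those with \<open>m\<close> bad split the plaque into two
  disjoint open parts, and by connectedness the part containing \<open>q\<close> is everything.\<close>

lemma plaque_independence:
  assumes i: "i \<in> A" and k: "k \<in> A" "q \<in> W k" and l: "l \<in> A" "q' \<in> W l"
    and q: "q \<in> flow_box i" "q' \<in> flow_box i" "transverse_coord i q = s" "transverse_coord i q' = s"
  obtains V where "openin T V" "s \<in> V" "V \<subseteq> dom (holonomy i k) \<inter> dom (holonomy i l)"
    "\<And>x y. \<lbrakk>x \<in> V; y \<in> V\<rbrakk> \<Longrightarrow>
       \<rho> (the (holonomy i k x)) (the (holonomy i k y)) = \<rho> (the (holonomy i l x)) (the (holonomy i l y))"
proof -
  define G where "G m \<longleftrightarrow> (\<exists>V. openin T V \<and> s \<in> V \<and> V \<subseteq> dom (holonomy i k) \<inter> dom (holonomy i m) \<and>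
    (\<forall>x\<in>V. \<forall>y\<in>V. \<rho> (the (holonomy i k x)) (the (holonomy i k y)) =
       \<rho> (the (holonomy i m x)) (the (holonomy i m y))))" for m
  have step: "G m" if lm: "l \<in> A" "m \<in> A" "p \<in> W l" "p \<in> W m" "p \<in> flow_box i"
      "transverse_coord i p = s" and "G l" for l m p
  proof -
    have p: "p \<in> flow_box i \<inter> flow_box l \<inter> flow_box m" using lm W_subset by blast
    obtain V1 where V1: "openin T V1" "s \<in> V1" "V1 \<subseteq> dom (holonomy i k) \<inter> dom (holonomy i l)"
      "\<forall>x\<in>V1. \<forall>y\<in>V1. \<rho> (the (holonomy i k x)) (the (holonomy i k y)) =
         \<rho> (the (holonomy i l x)) (the (holonomy i l y))"
      using \<open>G l\<close> unfolding G_def by (elim exE conjE) 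
    obtain V2 where V2: "openin T V2" "transverse_coord l p \<in> V2" 
      "\<forall>x\<in>V2. \<forall>y\<in>V2. \<rho> (the (holonomy l m x)) (the (holonomy l m y)) = \<rho> x y"
      using short [OF lm(1-4)] by (elim exE conjE)
    obtain V3 where V3: "openin T V3" "s \<in> V3" "\<And>x. x \<in> V3 \<Longrightarrow> \<exists>y z. holonomy i l x = Some y \<and>
        holonomy l m y = Some z \<and> holonomy i m x = Some z"
      using holonomy_cocycle [OF i lm(1,2) p] lm(6) by metis
    let ?V = "V1 \<inter> V3 \<inter> {x. \<exists>y\<in>V2. holonomy i l x = Some y}"
    have "openin T ?V" using V1(1) V3(1) openin_holonomy_preimage [OF i lm(1) V2(1)] by blast
    moreover have "s \<in> ?V"
      using V1(2) V3(2) V2(2) holonomy_transverse_coord [OF i lm(1)] p lm(6) by blast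
    moreover have "?V \<subseteq> dom (holonomy i k) \<inter> dom (holonomy i m)"
      using V1(3) V3(3) by blast
    moreover have "\<rho> (the (holonomy i k x)) (the (holonomy i k y)) =
        \<rho> (the (holonomy i m x)) (the (holonomy i m y))" if x: "x \<in> ?V" and y: "y \<in> ?V" for x y
    proof -
      obtain x1 x2 where x': "x1 \<in> V2" "holonomy i l x = Some x1" "holonomy l m x1 = Some x2"
          "holonomy i m x = Some x2"
        using x V3(3) [of x] by auto
      obtain y1 y2 where y': "y1 \<in> V2" "holonomy i l y = Some y1" "holonomy l m y1 = Some y2"
          "holonomy i m y = Some y2"
        using y V3(3) [of y] by auto
      have "\<rho> (the (holonomy i k x)) (the (holonomy i k y)) = \<rho> x1 y1"
        using V1(4) x y x' y' by auto
      moreover have "\<rho> x2 y2 = \<rho> x1 y1" using V2(3) x' y' by fastforce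
      ultimately show ?thesis using x' y' by simp
    qed
    ultimately show ?thesis unfolding G_def by (intro exI [of _ ?V]) simp
  qed
  define P where "P = {p \<in> flow_box i. transverse_coord i p = s}"
  define E1 where "E1 = \<Union>(W ` {m \<in> A. G m})"
  define E2 where "E2 = \<Union>(W ` {m \<in> A. \<not> G m})"
  have "connectedin M P" unfolding P_def by (rule connectedin_transverse_fibre [OF i])
  moreover have "openin M E1" "openin M E2"
    unfolding E1_def E2_def using W_open by auto
  moreover have "P \<subseteq> E1 \<union> E2"
  proof
    fix p assume "p \<in> P"
    then obtain m where "m \<in> A" "p \<in> W m" using W_coverE [OF i] unfolding P_def by blast
    then show "p \<in> E1 \<union> E2" unfolding E1_def E2_def by blast
  qed
  moreover have "E1 \<inter> E2 \<inter> P = {}"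
    unfolding E1_def E2_def P_def using step by blast
  moreover have "E1 \<inter> P \<noteq> {}"
  proof -
    have "s \<in> dom (holonomy i k)"
      using holonomy_transverse_coord [OF i k(1), of q] q W_subset k by blast
    then have "G k" unfolding G_def using openin_dom_holonomy [OF i k(1)] by blast
    then have "q \<in> E1 \<inter> P" using q k unfolding E1_def P_def by blast
    then show ?thesis by blast
  qed
  ultimately have "E2 \<inter> P = {}" unfolding connectedin by blast
  then have "G l" using l q unfolding E2_def P_def by blast
  then show thesis using that unfolding G_def by (elim exE conjE) simp
qed

text \<open>The new metric is \<open>\<rho>\<close> pulled back along \<open>h\<close>, which transports each point by holonomy into a
  chart \<open>\<kappa> x\<close> whose set \<open>W (\<kappa> x)\<close> its plaque meets. If \<open>\<sigma>\<^sub>a\<^sub>b\<close> sends \<open>s\<close> to \<open>t\<close>, the plaques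
  of \<open>s\<close> and \<open>t\<close> share a point, which lies in some \<open>W m\<close>; by independence of the chart, near \<open>s\<close> and
  near \<open>t\<close> the metric may be computed by transport to \<open>m\<close>, and these two transports differ by exactly
  \<open>\<sigma>\<^sub>a\<^sub>b\<close>.\<close>

lemma invariant_transverse_metric:
  assumes "Lindelof_space T" "zero_dimensional_space T"
    and \<rho>: "compatible_metric T \<rho>" and le1: "\<And>x y. \<rho> x y \<le> 1"
  shows "\<exists>d. compatible_metric T d \<and> preserves_metric T (holonomy_pseudogroup A) d"
proof -
  define U where "U k = (\<Union>i\<in>A. transverse_coord i ` (flow_box i \<inter> W k))" for k
  have open_UN: "openin T (\<Union>i\<in>I. f i)" if "\<And>i. i \<in> I \<Longrightarrow> openin T (f i)"
    for I :: "('m, 'x) flow_chart set" and f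
    using that by (auto intro: openin_Union)
  have cover: "\<exists>k\<in>A. x \<in> U k" if x: "x \<in> topspace T" for x
  proof -
    obtain p where p: "fst x \<in> A" "p \<in> flow_box (fst x)" "transverse_coord (fst x) p = x"
      using transverse_coord_surj [OF x] .
    obtain k where k: "k \<in> A" "p \<in> W k" using W_coverE [OF p(1,2)] .
    have "x \<in> transverse_coord (fst x) ` (flow_box (fst x) \<inter> W k)"
      using p(2,3) k(2) by (intro image_eqI [of _ _ p]) simp_all
    then have "x \<in> U k" unfolding U_def using p(1) by (rule UN_I [rotated])
    then show ?thesis using k(1) by blast
  qed
  have U_open: "openin T (U k)" if "k \<in> A" for k
    unfolding U_def
  proof (rule open_UN)
    fix i assume "i \<in> A"
    then show "openin T (transverse_coord i ` (flow_box i \<inter> W k))"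
      using open_image_transverse_coord flow_box_open W_open [OF that] by (simp add: openin_Int)
  qed
  obtain \<kappa> where \<kappa>: "\<And>x. x \<in> topspace T \<Longrightarrow> \<kappa> x \<in> A \<and> x \<in> U (\<kappa> x)"
    and \<kappa>_open: "\<And>k. openin T {x \<in> topspace T. \<kappa> x = k}"
  proof (rule locally_constant_selection [OF assms(2,1) cover U_open])
    fix f assume f: "\<And>x. x \<in> topspace T \<Longrightarrow> f x \<in> A \<and> x \<in> U (f x)"
      "\<And>k. openin T {x \<in> topspace T. f x = k}"
    show thesis by (rule that [OF f])
  qed
  define l where "l x = (fst x, \<kappa> x)" for x
  define h where "h x = the (holonomy (fst x) (\<kappa> x) x)" for x
  define d where "d = labelled_pullback l h \<rho>"
  \<comment> \<open>The sheets of the label, on each of which \<open>h\<close> is a single holonomy transformation.\<close>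
  define F where "F i k = {x \<in> topspace T. l x = (i, k)}" for i k
  have sheet: "fst x \<in> A \<and> \<kappa> x \<in> A \<and> (\<exists>p \<in> flow_box (fst x) \<inter> W (\<kappa> x). transverse_coord (fst x) p = x)
      \<and> holonomy (fst x) (\<kappa> x) x = Some (h x)" if x: "x \<in> topspace T" for x
  proof -
    obtain i p where p: "i \<in> A" "p \<in> flow_box i" "p \<in> W (\<kappa> x)" "transverse_coord i p = x"
      using \<kappa> [OF x] unfolding U_def by blast
    have [simp]: "fst x = i" using p(4) by (auto simp: transverse_coord_def)
    have "p \<in> flow_box (\<kappa> x)" using \<kappa> [OF x] p(3) W_subset by blast
    then have "holonomy i (\<kappa> x) x = Some (transverse_coord (\<kappa> x) p)"
      using holonomy_transverse_coord p \<kappa> [OF x] by blast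
    then show ?thesis using p \<kappa> [OF x] unfolding h_def by auto
  qed
  have F_open: "openin T (F i k)" for i k
  proof -
    have "openin T {x \<in> topspace T. fst x = i}"
      unfolding complete_transversal_def openin_sum_topology
    proof (intro conjI ballI)
      fix j assume "j \<in> A"
      then have "{y. (j, y) \<in> {x \<in> topspace (sum_topology transversal A). fst x = i}}
          = (if j = i then topspace (transversal j) else {})"
        by auto
      then show "openin (transversal j) {y. (j, y) \<in> {x \<in> topspace (sum_topology transversal A). fst x = i}}"
        by simp
    qed auto
    moreover have "F i k = {x \<in> topspace T. fst x = i} \<inter> {x \<in> topspace T. \<kappa> x = k}"
      by (auto simp: F_def l_def)
    ultimately show ?thesis using \<kappa>_open by auto
  qed
  have h_F: "h x = the (holonomy i k x)" if "x \<in> F i k" for x i k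
    using that by (auto simp: F_def l_def h_def)
  have h_in: "h x \<in> topspace T" if "x \<in> topspace T" for x
    using sheet [OF that] bicontinuous_holonomy unfolding bicontinuous_def by (meson ranI subsetD)
  have cont: "continuous_map T T h"
    unfolding continuous_map_def
  proof (intro conjI allI impI)
    show "h \<in> topspace T \<rightarrow> topspace T" using h_in by blast
    fix O' assume O': "openin T O'"
    have "{x \<in> topspace T. h x \<in> O'} =
        (\<Union>i\<in>A. \<Union>k\<in>A. F i k \<inter> {x. \<exists>y\<in>O'. holonomy i k x = Some y})"
    proof (intro set_eqI iffI)
      fix x assume "x \<in> {x \<in> topspace T. h x \<in> O'}"
      then show "x \<in> (\<Union>i\<in>A. \<Union>k\<in>A. F i k \<inter> {x. \<exists>y\<in>O'. holonomy i k x = Some y})"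
        using sheet [of x] by (auto simp: F_def l_def)
    next
      fix x assume "x \<in> (\<Union>i\<in>A. \<Union>k\<in>A. F i k \<inter> {x. \<exists>y\<in>O'. holonomy i k x = Some y})"
      then obtain i k y where "x \<in> F i k" "y \<in> O'" "holonomy i k x = Some y" by blast
      then have "h x = y" "x \<in> topspace T" using h_F [of x i k] by (auto simp: F_def)
      then show "x \<in> {x \<in> topspace T. h x \<in> O'}" using \<open>y \<in> O'\<close> by blast
    qed
    then show "openin T {x \<in> topspace T. h x \<in> O'}"
      by (simp only:) (intro open_UN openin_Int F_open openin_holonomy_preimage O')
  qed
  have op: "open_map T T h"
    unfolding open_map_def
  proof (intro allI impI)
    fix O' assume O': "openin T O'"
    have "h ` O' = (\<Union>i\<in>A. \<Union>k\<in>A. {y. \<exists>x\<in>O' \<inter> F i k. holonomy i k x = Some y})"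
    proof (intro set_eqI iffI)
      fix y assume "y \<in> h ` O'"
      then obtain x where x: "x \<in> O'" "y = h x" by blast
      then have xT: "x \<in> topspace T" using O' openin_subset by blast
      then have "x \<in> F (fst x) (\<kappa> x)" by (simp add: F_def l_def)
      then show "y \<in> (\<Union>i\<in>A. \<Union>k\<in>A. {y. \<exists>x\<in>O' \<inter> F i k. holonomy i k x = Some y})"
        using sheet [OF xT] x by blast
    next
      fix y assume "y \<in> (\<Union>i\<in>A. \<Union>k\<in>A. {y. \<exists>x\<in>O' \<inter> F i k. holonomy i k x = Some y})"
      then obtain i k x where "x \<in> O'" "x \<in> F i k" "holonomy i k x = Some y" by blast
      then show "y \<in> h ` O'" using h_F [of x i k] by force
    qed
    moreover have "openin T {y. \<exists>x\<in>O' \<inter> F i k. holonomy i k x = Some y}" if "i \<in> A" "k \<in> A" for i k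
      using bicontinuous_holonomy [OF that] openin_Int [OF O' F_open [of i k]]
      unfolding bicontinuous_def by meson
    ultimately show "openin T (h ` O')" by (simp only:) (intro open_UN)
  qed
  have inj: "x = y" if "x \<in> topspace T" "y \<in> topspace T" "l x = l y" "h x = h y" for x y
  proof -
    have "holonomy (fst x) (\<kappa> x) x = Some (h x)" "holonomy (fst x) (\<kappa> x) y = Some (h x)"
      using sheet [OF that(1)] sheet [OF that(2)] that(3,4) by (simp_all add: l_def)
    then show ?thesis
      using bicontinuous_inj [OF bicontinuous_holonomy] sheet [OF that(1)] by blast
  qed
  have l_open: "openin T {x \<in> topspace T. l x = z}" for z
    using F_open [of "fst z" "snd z"] by (simp add: F_def)
  have "compatible_metric T d"
    unfolding d_def by (rule compatible_labelled_pullback [OF \<rho> le1 l_open cont op inj])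
  moreover have "locally_isometric T d (holonomy a b)" if a: "a \<in> A" and b: "b \<in> A" for a b
    unfolding locally_isometric_def
  proof
    fix s assume "s \<in> dom (holonomy a b)"
    then obtain t where st: "holonomy a b s = Some t" by blast
    then obtain p where p: "p \<in> flow_box a" "p \<in> flow_box b"
      "transverse_coord a p = s" "transverse_coord b p = t"
      using holonomy_eq_Some [OF a b] by blast
    \<comment> \<open>The chart through which both sides are compared.\<close>
    obtain m where m: "m \<in> A" "p \<in> W m" using W_coverE [OF a p(1)] .
    have sT: "s \<in> topspace T" and tT: "t \<in> topspace T"
      using p transverse_coord_in a b by auto
    have fst: "fst s = a" "fst t = b" using p by (auto simp: transverse_coord_def)
    define k where "k = \<kappa> s"
    define k' where "k' = \<kappa> t"
    obtain q where q: "k \<in> A" "q \<in> flow_box a" "q \<in> W k" "transverse_coord a q = s"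
      using sheet [OF sT] fst unfolding k_def by blast
    obtain q' where q': "k' \<in> A" "q' \<in> flow_box b" "q' \<in> W k'" "transverse_coord b q' = t"
      using sheet [OF tT] fst unfolding k'_def by blast
    obtain V1 where V1: "openin T V1" "s \<in> V1" "V1 \<subseteq> dom (holonomy a k) \<inter> dom (holonomy a m)"
      "\<And>x y. \<lbrakk>x \<in> V1; y \<in> V1\<rbrakk> \<Longrightarrow>
       \<rho> (the (holonomy a k x)) (the (holonomy a k y)) = \<rho> (the (holonomy a m x)) (the (holonomy a m y))"
      using plaque_independence [OF a q(1,3) m q(2) p(1) q(4) p(3)] by metis
    obtain V2 where V2: "openin T V2" "t \<in> V2" "V2 \<subseteq> dom (holonomy b k') \<inter> dom (holonomy b m)"
      "\<And>x y. \<lbrakk>x \<in> V2; y \<in> V2\<rbrakk> \<Longrightarrow>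
       \<rho> (the (holonomy b k' x)) (the (holonomy b k' y)) = \<rho> (the (holonomy b m x)) (the (holonomy b m y))"
      using plaque_independence [OF b q'(1,3) m q'(2) p(2) q'(4) p(4)] by metis
    have "p \<in> flow_box a \<inter> flow_box b \<inter> flow_box m" using p m W_subset by blast
    then obtain V3 where V3: "openin T V3" "s \<in> V3"
      "\<And>x. x \<in> V3 \<Longrightarrow> \<exists>y z. holonomy a b x = Some y \<and> holonomy b m y = Some z \<and> holonomy a m x = Some z"
      using holonomy_cocycle [OF a b m(1)] p(3) by metis
    let ?V = "(V1 \<inter> F a k) \<inter> V3 \<inter> {x. \<exists>y\<in>V2 \<inter> F b k'. holonomy a b x = Some y}"
    have "openin T (V2 \<inter> F b k')" using V2(1) F_open by blast
    then have "openin T ?V"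
      using V1(1) V3(1) F_open openin_holonomy_preimage [OF a b] by blast
    moreover have "s \<in> ?V"
      using V1(2) V3(2) V2(2) st sT tT fst by (auto simp: F_def l_def k_def k'_def)
    moreover have "?V \<subseteq> dom (holonomy a b)" by blast
    moreover have "d (the (holonomy a b x)) (the (holonomy a b y)) = d x y"
      if x: "x \<in> ?V" and y: "y \<in> ?V" for x y
    proof -
      obtain x' xm where x': "holonomy a b x = Some x'" "x' \<in> V2" "x' \<in> F b k'"
          "holonomy b m x' = Some xm" "holonomy a m x = Some xm"
        using x V3(3) [of x] by auto
      obtain y' ym where y': "holonomy a b y = Some y'" "y' \<in> V2" "y' \<in> F b k'"
          "holonomy b m y' = Some ym" "holonomy a m y = Some ym"
        using y V3(3) [of y] by auto
      have "d x' y' = \<rho> (h x') (h y')"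
        using x' y' by (simp add: d_def labelled_pullback_def F_def)
      also have "\<dots> = \<rho> xm ym" using V2(4) x' y' h_F by simp
      also have "\<dots> = \<rho> (h x) (h y)" using V1(4) [of x y] x y x' y' h_F [of _ a k] by simp
      also have "\<dots> = d x y" using x y by (simp add: d_def labelled_pullback_def F_def)
      finally show ?thesis using x' y' by simp
    qed
    ultimately show "\<exists>V. openin T V \<and> s \<in> V \<and> V \<subseteq> dom (holonomy a b) \<and>
        (\<forall>x\<in>V. \<forall>y\<in>V. d (the (holonomy a b x)) (the (holonomy a b y)) = d x y)"
      by (intro exI [of _ ?V] conjI ballI)
  qed
  then have "preserves_metric T (holonomy_pseudogroup A) d"
    unfolding holonomy_pseudogroup_def
    by (intro generated_pseudogroup_preserves_metric)
      (auto simp: holonomy_transformations_def intro: bicontinuous_holonomy)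
  ultimately show ?thesis by blast
qed

end

section \<open>Equicontinuous laminations\<close>

text \<open>This supplies compactness of the inverse image of a compact open set under a holonomy
  transformation, as an image under the opposite transformation.\<close>

lemma compactin_bicontinuous_image:
  assumes g: "bicontinuous X g" and K: "compactin X K" "K \<subseteq> dom g"
  shows "compactin X {y. \<exists>x\<in>K. g x = Some y}"
proof -
  have td: "topspace (subtopology X (dom g)) = dom g"
    using g unfolding bicontinuous_def by auto
  have pre: "{x \<in> dom g. the (g x) \<in> U} = {x. \<exists>y\<in>U. g x = Some y}" for U by auto
  have "continuous_map (subtopology X (dom g)) X (\<lambda>x. the (g x))"
    unfolding continuous_map_def td pre
  proof (intro conjI allI impI)
    show "(\<lambda>x. the (g x)) \<in> dom g \<rightarrow> topspace X"
      using g unfolding bicontinuous_def by (auto intro: ranI)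
    fix U assume "openin X U"
    then have "openin X {x. \<exists>y\<in>U. g x = Some y}" using g unfolding bicontinuous_def by blast
    then show "openin (subtopology X (dom g)) {x. \<exists>y\<in>U. g x = Some y}"
      unfolding openin_subtopology by (intro exI [of _ "{x. \<exists>y\<in>U. g x = Some y}"]) auto
  qed
  moreover have "compactin (subtopology X (dom g)) K" using K by (simp add: compactin_subtopology)
  ultimately have "compactin X ((\<lambda>x. the (g x)) ` K)" by (rule image_compactin [rotated])
  moreover have "(\<lambda>x. the (g x)) ` K = {y. \<exists>x\<in>K. g x = Some y}" using K(2) by force
  ultimately show ?thesis by simp
qed

text \<open>A composite of restricted holonomy transformations that is defined somewhere must have matching
  consecutive charts, since a holonomy transformation from \<open>a\<close> to \<open>b\<close> lives on the summand of \<open>a\<close> and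
  takes values in that of \<open>b\<close>. The chain depends on the word alone, so the same chain serves every
  point at which the composite is defined. The condition on \<open>hd cs\<close> is what the induction needs.\<close>

lemma (in foliated_space) composite_holonomy_chain:
  assumes S: "\<And>g. g \<in> S \<Longrightarrow> \<exists>a\<in>A. \<exists>b\<in>A. g \<subseteq>\<^sub>m holonomy a b"
    and "w \<in> lists S" "w \<noteq> []" "composite w x = Some x'"
  shows "\<exists>cs. flow_chain A cs \<and> hd cs = fst x \<and>
    (\<forall>z z'. composite w z = Some z' \<longrightarrow> holonomy_along cs z = Some z')"
  using assms(2-4)
proof (induction w arbitrary: x rule: list.induct)
  case (Cons g w)
  then obtain a b where ab: "a \<in> A" "b \<in> A" "g \<subseteq>\<^sub>m holonomy a b" using S [of g] by auto
  have g: "holonomy a b z = Some u" if "g z = Some u" for z u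
    using ab(3) that unfolding map_le_def by (metis domI)
  obtain y where y: "g x = Some y" "composite w y = Some x'"
    using Cons.prems(3) by (auto simp: map_comp_def split: option.splits)
  have fst: "fst x = a" "fst y = b" using holonomy_fst [OF ab(1,2) g [OF y(1)]] by auto
  have meet: "flow_box a \<inter> flow_box b \<noteq> {}"
    using g [OF y(1)] holonomy_eq_Some [OF ab(1,2)] by blast
  show ?case
  proof (cases "w = []")
    case True
    have "flow_chain A [a, b]" using ab meet by (simp add: flow_chain_def)
    moreover have "holonomy_along [a, b] z = Some z'" if "composite (g # w) z = Some z'" for z z'
      using that True g [of z] by (cases "g z") (auto simp: map_comp_def)
    ultimately show ?thesis using fst by (intro exI [of _ "[a, b]"]) simp
  next
    case False
    then obtain cs where cs: "flow_chain A cs" "hd cs = b"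
      "\<And>z z'. composite w z = Some z' \<Longrightarrow> holonomy_along cs z = Some z'"
      using Cons.IH [of y] Cons.prems y(2) fst(2) by auto
    then obtain c ds where ds: "cs = b # c # ds"
      unfolding flow_chain_def by (cases cs; cases "tl cs") auto
    have "flow_chain A (a # cs)" using cs(1) ab meet ds by (simp add: flow_chain_def)
    moreover have "holonomy_along (a # cs) z = Some z'" if "composite (g # w) z = Some z'" for z z'
    proof -
      obtain u where u: "g z = Some u"
        using \<open>composite (g # w) z = Some z'\<close> by (cases "g z") (auto simp: map_comp_def)
      then have "composite w u = Some z'" using \<open>composite (g # w) z = Some z'\<close> by simp
      with u show ?thesis using cs(3) [of u z'] g [of z u] ds by simp
    qed
    ultimately show ?thesis using fst by (intro exI [of _ "a # cs"]) simp
  qed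
qed simp

lemma good_atlas_compact_space:
  assumes "foliated_atlas r n M A" "good_atlas M L A"
  shows "compact_space M"
proof -
  have "compactin M (\<Union>a\<in>A. M closure_of flow_box a)"
    using assms(2) unfolding good_atlas_def by (intro compactin_Union) auto
  moreover have "(\<Union>a\<in>A. M closure_of flow_box a) = topspace M"
  proof (intro subset_antisym)
    have "flow_box a \<subseteq> M closure_of flow_box a" if "a \<in> A" for a
      using assms(1) that unfolding foliated_atlas_def is_flow_chart_def
      by (intro closure_of_subset openin_subset) blast
    then show "topspace M \<subseteq> (\<Union>a\<in>A. M closure_of flow_box a)"
      using assms(1) unfolding foliated_atlas_def by blast
  qed (use closure_of_subset_topspace in fast)
  ultimately show ?thesis by (simp add: compact_space_def)
qed

theorem theorem6p3:
  fixes r :: enat and n :: nat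
    and M :: "'m topology"
    and L :: "('m, 'x) flow_chart set set"
    and A :: "('m, 'x) flow_chart set"
  assumes "lamination r n M L"
    and "good_atlas M L A"
    and "codimension_zero A"
    and "equicontinuous_atlas A"
  shows "\<exists>d. compatible_metric (complete_transversal A) d \<and>
             preserves_metric (complete_transversal A) (holonomy_pseudogroup A) d"
proof -
  have fol: "foliated_atlas r n M A"
    using assms(1,2) unfolding lamination_def good_atlas_def
    by (auto simp: quotient_def atlas_equiv_def)
  interpret foliated_space r n M A by unfold_locales (rule fol)
  have finA: "finite A" using assms(2) by (simp add: good_atlas_def)
  have M: "compact_space M" "Hausdorff_space M"
    using good_atlas_compact_space [OF fol assms(2)] Polish_imp_Hausdorff assms(1)
    by (auto simp: lamination_def)
  have T: "locally_compact_space T" "Hausdorff_space T" "zero_dimensional_space T" "Lindelof_space T"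
    using assms(3) Polish_imp_Hausdorff Polish_imp_Lindelof
    by (auto simp: codimension_zero_def Let_def)
  obtain W N where WN: "\<And>a. a \<in> A \<Longrightarrow>
        openin M (W a) \<and> compactin M (N a) \<and> W a \<subseteq> N a \<and> N a \<subseteq> flow_box a"
    and W_cover: "(\<Union>a\<in>A. W a) = topspace M"
    using compact_shrinking [OF M, of A flow_box] fol flow_box_open
    unfolding foliated_atlas_def by metis
  have "\<exists>C. compactin T C \<and> openin T C \<and> transverse_coord a ` (N a \<inter> N b) \<subseteq> C \<and> C \<subseteq> dom (holonomy a b)"
    if a: "a \<in> A" and b: "b \<in> A" for a b
  proof -
    have "compactin M (N a \<inter> N b)"
      using WN [OF a] WN [OF b] compactin_imp_closedin [OF M(2)] compact_Int_closedin by blast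
    then have "compactin (subtopology M (flow_box a)) (N a \<inter> N b)"
      using WN [OF a] by (simp add: compactin_subtopology le_infI1)
    then have "compactin T (transverse_coord a ` (N a \<inter> N b))"
      using image_compactin continuous_transverse_coord [OF a] by blast
    moreover have "transverse_coord a ` (N a \<inter> N b) \<subseteq> dom (holonomy a b)"
      using WN [OF a] WN [OF b] holonomy_transverse_coord [OF a b] by blast
    ultimately show ?thesis
      using compact_open_between [OF T(1-3) _ openin_dom_holonomy [OF a b]] by metis
  qed
  then obtain C where C: "\<And>a b. a \<in> A \<Longrightarrow> b \<in> A \<Longrightarrow> compactin T (C a b) \<and> openin T (C a b) \<and>
      transverse_coord a ` (N a \<inter> N b) \<subseteq> C a b \<and> C a b \<subseteq> dom (holonomy a b)"
    by metis
  \<comment> \<open>Cutting down on both sides makes the restricted maps \<open>\<sigma> a b\<close> and \<open>\<sigma> b a\<close> inverse to each other.\<close>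
  define C' where "C' a b = C a b \<inter> {x. \<exists>y\<in>C b a. holonomy a b x = Some y}" for a b
  define \<sigma> where "\<sigma> a b = holonomy a b |` C' a b" for a b
  define S where "S = (\<lambda>(a, b). \<sigma> a b) ` (A \<times> A)"
  have \<sigma>_eq: "\<sigma> a b x = Some y \<longleftrightarrow> x \<in> C a b \<and> y \<in> C b a \<and> holonomy a b x = Some y" for a b x y
    by (auto simp: \<sigma>_def C'_def restrict_map_def)
  have \<sigma>_sym: "\<sigma> a b x = Some y \<longleftrightarrow> \<sigma> b a y = Some x" if "a \<in> A" "b \<in> A" for a b x y
    unfolding \<sigma>_eq using holonomy_sym [OF that] by blast
  have dom_\<sigma>: "dom (\<sigma> a b) = C' a b" for a b by (auto simp: \<sigma>_def C'_def)
  have C': "compactin T (C' a b) \<and> openin T (C' a b)" if a: "a \<in> A" and b: "b \<in> A" for a b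
  proof -
    have "compactin T {x. \<exists>y\<in>C b a. holonomy b a y = Some x}"
      using compactin_bicontinuous_image [OF bicontinuous_holonomy [OF b a]] C [OF b a] by blast
    then have "compactin T {x. \<exists>y\<in>C b a. holonomy a b x = Some y}"
      using holonomy_sym [OF a b] by simp
    then have "compactin T (C' a b)"
      unfolding C'_def using C [OF a b] compactin_imp_closedin [OF T(2)] compact_Int_closedin by blast
    moreover have "openin T (C' a b)"
      unfolding C'_def using C [OF a b] C [OF b a] openin_holonomy_preimage [OF a b] by blast
    ultimately show ?thesis by blast
  qed
  obtain d where d: "compatible_metric T d" and equi: "\<And>\<epsilon>. \<epsilon> > 0 \<Longrightarrow> \<exists>\<delta>>0. \<forall>cs. flow_chain A cs \<longrightarrow>
          (\<forall>x \<in> dom (holonomy_along cs). \<forall>y \<in> dom (holonomy_along cs).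
             d x y < \<delta> \<longrightarrow> d (the (holonomy_along cs x)) (the (holonomy_along cs y)) < \<epsilon>)"
    using assms(4) unfolding equicontinuous_atlas_def by blast
  interpret D: Metric_space "topspace T" d using d by (simp add: compatible_metric_def)
  have DT: "D.mtopology = T" using d by (simp add: compatible_metric_def)
  have S_le: "\<exists>a\<in>A. \<exists>b\<in>A. g \<subseteq>\<^sub>m holonomy a b" if "g \<in> S" for g
  proof -
    obtain a b where "a \<in> A" "b \<in> A" "g = \<sigma> a b" using \<open>g \<in> S\<close> unfolding S_def by auto
    moreover have "\<sigma> a b \<subseteq>\<^sub>m holonomy a b" by (auto simp: \<sigma>_def map_le_def)
    ultimately show ?thesis by blast
  qed
  interpret E: equicontinuous_family "topspace T" d S
  proof unfold_locales
    fix g assume "g \<in> S"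
    then obtain a b where ab: "a \<in> A" "b \<in> A" "g = \<sigma> a b" unfolding S_def by auto
    then have "ran g \<subseteq> ran (holonomy a b)" using \<sigma>_eq by (auto simp: ran_def)
    then show "ran g \<subseteq> topspace T"
      using bicontinuous_holonomy [OF ab(1,2)] unfolding bicontinuous_def by blast
  next
    have "finite (dom ` S)" unfolding S_def using finA by simp
    moreover have "compactin D.mtopology K \<and> openin D.mtopology K" if "K \<in> dom ` S" for K
      using that C' unfolding DT S_def by (auto simp: dom_\<sigma>)
    ultimately have "\<exists>\<epsilon>>0. \<forall>K\<in>dom ` S. \<forall>x\<in>topspace T. \<forall>y\<in>topspace T. d x y < \<epsilon> \<longrightarrow> (x \<in> K \<longleftrightarrow> y \<in> K)"
      by (rule D.finite_compact_open_separated)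
    then show "\<exists>\<epsilon>>0. \<forall>g\<in>S. \<forall>x\<in>topspace T. \<forall>y\<in>topspace T. d x y < \<epsilon> \<longrightarrow> (x \<in> dom g \<longleftrightarrow> y \<in> dom g)"
      by (simp only: ball_simps)
  next
    fix \<epsilon> :: real assume "\<epsilon> > 0"
    then obtain \<delta> where \<delta>: "\<delta> > 0" "\<And>cs x y. flow_chain A cs \<Longrightarrow> x \<in> dom (holonomy_along cs) \<Longrightarrow>
        y \<in> dom (holonomy_along cs) \<Longrightarrow> d x y < \<delta> \<Longrightarrow>
        d (the (holonomy_along cs x)) (the (holonomy_along cs y)) < \<epsilon>"
      using equi by meson
    have close: "d x' y' < \<epsilon>" if w: "w \<in> lists S" "composite w x = Some x'" "composite w y = Some y'"
      "d x y < min \<delta> \<epsilon>" for w x y x' y'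
    proof (cases "w = []")
      case True
      then show ?thesis using w by simp
    next
      case False
      then obtain cs where "flow_chain A cs"
        "\<forall>z z'. composite w z = Some z' \<longrightarrow> holonomy_along cs z = Some z'"
        using composite_holonomy_chain [OF S_le w(1) _ w(2)] by blast
      then have "holonomy_along cs x = Some x'" "holonomy_along cs y = Some y'" "flow_chain A cs"
        using w(2,3) by blast+
      then show ?thesis using \<delta>(2) [of cs x y] w(4) by (simp add: domI)
    qed
    \<comment> \<open>Taking \<open>\<delta> \<le> \<epsilon>\<close> covers the empty composite, which is not a chain of flow boxes.\<close>
    then show "\<exists>\<delta>>0. \<forall>w\<in>lists S. \<forall>x\<in>topspace T. \<forall>y\<in>topspace T. \<forall>x' y'.
        composite w x = Some x' \<and> composite w y = Some y' \<and> d x y < \<delta> \<longrightarrow> d x' y' < \<epsilon>"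
    proof (intro exI conjI ballI allI impI)
      show "min \<delta> \<epsilon> > 0" using \<delta>(1) \<open>\<epsilon> > 0\<close> by simp
    qed (elim conjE, rule close)
  qed
  interpret leafwise_invariant_metric r n M A W "orbit_dist S d"
  proof unfold_locales
    show "openin M (W a)" "W a \<subseteq> flow_box a" if "a \<in> A" for a using WN [OF that] by auto
    show "(\<Union>a\<in>A. W a) = topspace M" by (rule W_cover)
    fix a b p assume ab: "a \<in> A" "b \<in> A" and p: "p \<in> W a" "p \<in> W b"
    then have pN: "p \<in> N a \<inter> N b" "p \<in> N b \<inter> N a" and pU: "p \<in> flow_box a" "p \<in> flow_box b"
      using WN by blast+
    have "transverse_coord a p \<in> C a b" "transverse_coord b p \<in> C b a"
      using C [OF ab] C [OF ab(2,1)] pN by blast+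
    then have "transverse_coord a p \<in> C' a b"
      using holonomy_transverse_coord [OF ab pU] unfolding C'_def by blast
    moreover have "orbit_dist S d (the (holonomy a b x)) (the (holonomy a b y)) = orbit_dist S d x y"
      if x: "x \<in> C' a b" and y: "y \<in> C' a b" for x y
    proof -
      obtain x' y' where x': "\<sigma> a b x = Some x'" and y': "\<sigma> a b y = Some y'"
        using x y dom_\<sigma> by blast
      have S: "\<sigma> a b \<in> S" "\<sigma> b a \<in> S" using ab by (auto simp: S_def)
      \<comment> \<open>Neither \<open>\<sigma> a b\<close> nor its inverse \<open>\<sigma> b a\<close> increases the orbit metric.\<close>
      have "orbit_dist S d x' y' = orbit_dist S d x y"
        using E.orbit_dist_map_le [OF S(1) x' y']
          E.orbit_dist_map_le [OF S(2), of x' x y' y] \<sigma>_sym [OF ab] x' y' by simp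
      then show ?thesis using x' y' unfolding \<sigma>_eq by simp
    qed
    moreover have "C' a b \<subseteq> dom (holonomy a b)" by (auto simp: C'_def)
    ultimately show "\<exists>V. openin T V \<and> transverse_coord a p \<in> V \<and> V \<subseteq> dom (holonomy a b) \<and>
         (\<forall>x\<in>V. \<forall>y\<in>V. orbit_dist S d (the (holonomy a b x)) (the (holonomy a b y)) = orbit_dist S d x y)"
      using C' [OF ab] by (intro exI [of _ "C' a b"]) simp
  qed
  have "compatible_metric T (orbit_dist S d)"
    unfolding compatible_metric_def
    using E.Metric_space_orbit_dist E.mtopology_orbit_dist DT by simp
  then show ?thesis
    using invariant_transverse_metric [OF T(4,3)] E.orbit_dist_le_1 by blast
qed

end
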